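(* Let $\mathcal T$ be a toric trinity, $X$ one of the three colors, and $W$ a wreath in $G_X^*$ containing exactly $k$ cycles. Then there are exactly $2^k$ states of $\mathcal T$ extending $W$, i.e., states whose set of arrows of color $X$ is exactly $W$.
   Context: A trinity is a triangulation $\mathcal T$ of a compact connected oriented closed surface $\Sigma$ whose vertices are colored red, green, blue so that the endpoints of every edge have different colors. A toric trinity is a trinity on the torus. A triangle is black if its vertices, read clockwise, appear in the cyclic order blue, green, red; otherwise white. An edge is given the color not occurring among its endpoints; each edge borders exactly one black and one white triangle. A state of a toric trinity is a bijection between the set of white triangles and the set of vertices matching each white triangle with one of its own vertices. For a color $X$, let $G_X^*$ be the directed graph embedded in $\Sigma$ whose vertices are the vertices of color $X$ and which has, for each edge $\epsilon$ of color $X$, one directed edge crossing $\epsilon$, going from the $X$-colored vertex of the black triangle containing $\epsilon$ to the $X$-colored vertex of the white triangle containing $\epsilon$. If a state matches a white triangle $T$ with a vertex $x$ of color $X$, the corresponding arrow of color $X$ is the edge of $G_X^*$ crossing the edge of $T$ opposite to $x$ (it ends at $x$). A wreath in $G_X^*$ is a set $W$ of edges of $G_X^*$ such that every vertex of color $X$ is the head of exactly one edge of $W$, and no cycle formed by edges of $W$ is separating on the torus. *)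

theory Defs
  imports "Graph_Theory.Arc_Walk" "HOL-Combinatorics.Orbits"
begin

text \<open>
  A cell decomposition of a closed oriented surface is given as a combinatorial map.  A dart is an
  edge together with a direction; \<open>flip\<close> reverses it, and \<open>nxt\<close> sends a dart to the following dart
  on the boundary of the face on its left, so \<open>nxt\<close> runs counterclockwise around each face.
  Vertices, edges and faces are the orbits of \<open>nxt \<circ> flip\<close> (turning around the initial point of
  a dart), \<open>flip\<close> and \<open>nxt\<close>.  The triangles of the decomposition may share several edges or
  vertices: it need not be a simplicial complex.
\<close>

datatype colour = Red | Green | Blue

record 'd tri_map =
  darts :: "'d set"
  nxt :: "'d \<Rightarrow> 'd"
  flip :: "'d \<Rightarrow> 'd"
  colouring :: "'d set \<Rightarrow> colour"

definition rot :: "'d tri_map \<Rightarrow> 'd \<Rightarrow> 'd" where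
  "rot T d = nxt T (flip T d)"

definition vertex_of :: "'d tri_map \<Rightarrow> 'd \<Rightarrow> 'd set" where
  "vertex_of T d = orbit (rot T) d"

definition edge_of :: "'d tri_map \<Rightarrow> 'd \<Rightarrow> 'd set" where
  "edge_of T d = {d, flip T d}"

definition triangle_of :: "'d tri_map \<Rightarrow> 'd \<Rightarrow> 'd set" where
  "triangle_of T d = orbit (nxt T) d"

definition vertices :: "'d tri_map \<Rightarrow> 'd set set" where
  "vertices T = vertex_of T ` darts T"

definition edges :: "'d tri_map \<Rightarrow> 'd set set" where
  "edges T = edge_of T ` darts T"

definition triangles :: "'d tri_map \<Rightarrow> 'd set set" where
  "triangles T = triangle_of T ` darts T"

text \<open>
  The colouring is only meaningful on \<open>vertices T\<close>.  A dart \<open>d\<close> runs from \<open>vertex_of T d\<close> to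
  \<open>vertex_of T (flip T d)\<close>.
\<close>

definition trinity :: "'d tri_map \<Rightarrow> bool" where
  "trinity T \<longleftrightarrow>
     finite (darts T) \<and> darts T \<noteq> {} \<and>
     bij_betw (nxt T) (darts T) (darts T) \<and>
     (\<forall>d\<in>darts T. flip T d \<in> darts T \<and> flip T (flip T d) = d \<and> flip T d \<noteq> d) \<and>
     (\<forall>f\<in>triangles T. card f = 3) \<and>
     (\<forall>d\<in>darts T. \<forall>d'\<in>darts T.
        (d, d') \<in> {(x, y). x \<in> darts T \<and> (y = nxt T x \<or> y = flip T x)}\<^sup>*) \<and>
     (\<forall>d\<in>darts T. colouring T (vertex_of T d) \<noteq> colouring T (vertex_of T (flip T d)))"

definition euler_characteristic :: "'d tri_map \<Rightarrow> int" where
  "euler_characteristic T =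
     int (card (vertices T)) - int (card (edges T)) + int (card (triangles T))"

text \<open>
  By the classification of surfaces, the torus is the closed connected oriented surface of Euler
  characteristic \<open>0\<close>.
\<close>

definition toric_trinity :: "'d tri_map \<Rightarrow> bool" where
  "toric_trinity T \<longleftrightarrow> trinity T \<and> euler_characteristic T = 0"

text \<open>
  Clockwise blue, green, red is counterclockwise blue, red, green.
\<close>

definition black :: "'d tri_map \<Rightarrow> 'd set \<Rightarrow> bool" where
  "black T f \<longleftrightarrow> (\<exists>d\<in>f. colouring T (vertex_of T d) = Blue \<and>
     colouring T (vertex_of T (nxt T d)) = Red \<and>
     colouring T (vertex_of T (nxt T (nxt T d))) = Green)"

definition white_triangles :: "'d tri_map \<Rightarrow> 'd set set" where
  "white_triangles T = {f \<in> triangles T. \<not> black T f}"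

definition black_triangles :: "'d tri_map \<Rightarrow> 'd set set" where
  "black_triangles T = {f \<in> triangles T. black T f}"

text \<open>
  An edge \<open>e\<close> has endpoints \<open>vertex_of T ` e\<close>, and a triangle \<open>f\<close> has corners \<open>vertex_of T ` f\<close>.
  An edge lies on a triangle iff they have a dart in common.
\<close>

definition edges_of_colour :: "'d tri_map \<Rightarrow> colour \<Rightarrow> 'd set set" where
  "edges_of_colour T X = {e \<in> edges T. X \<notin> colouring T ` vertex_of T ` e}"

definition vertices_of_colour :: "'d tri_map \<Rightarrow> colour \<Rightarrow> 'd set set" where
  "vertices_of_colour T X = {v \<in> vertices T. colouring T v = X}"

definition corner :: "'d tri_map \<Rightarrow> colour \<Rightarrow> 'd set \<Rightarrow> 'd set" where
  "corner T X f = (THE v. v \<in> vertex_of T ` f \<and> colouring T v = X)"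

definition black_side :: "'d tri_map \<Rightarrow> 'd set \<Rightarrow> 'd set" where
  "black_side T e = (THE f. f \<in> black_triangles T \<and> f \<inter> e \<noteq> {})"

definition white_side :: "'d tri_map \<Rightarrow> 'd set \<Rightarrow> 'd set" where
  "white_side T e = (THE f. f \<in> white_triangles T \<and> f \<inter> e \<noteq> {})"

text \<open>
  The directed graph \<open>G\<^sub>X\<^sup>*\<close>.  Its arc crossing the edge \<open>e\<close> is represented by \<open>e\<close> itself.
\<close>

definition dual_graph :: "'d tri_map \<Rightarrow> colour \<Rightarrow> ('d set, 'd set) pre_digraph" where
  "dual_graph T X = \<lparr> verts = vertices_of_colour T X, arcs = edges_of_colour T X,
     tail = (\<lambda>e. corner T X (black_side T e)), head = (\<lambda>e. corner T X (white_side T e)) \<rparr>"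

text \<open>
  Drawn on the surface, \<open>G\<^sub>X\<^sup>*\<close> runs through each triangle along the median from its corner of
  colour \<open>X\<close> to the midpoint of the opposite edge, which has colour \<open>X\<close>.  This cuts the triangle
  into two halves, each containing one corner that is not of colour \<open>X\<close>; a half is named by the
  dart of the triangle that starts at this corner.  Two halves touch along a segment in two ways:
  the halves \<open>d\<close> and \<open>rot T d\<close> lie on either side of the edge of \<open>d\<close> (or of the part of it up to
  its midpoint, if it has colour \<open>X\<close>), and if the edge of \<open>d\<close> has colour \<open>X\<close>, then \<open>d\<close> and
  \<open>nxt T d\<close> lie on either side of the median ending on that edge.  Cutting the surface along a set
  \<open>C\<close> of arcs of \<open>G\<^sub>X\<^sup>*\<close> removes exactly the contacts of the second kind at the edges in \<open>C\<close>, so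
  the components of the complement of \<open>C\<close> are the classes of halves still connected.
\<close>

definition halves :: "'d tri_map \<Rightarrow> colour \<Rightarrow> 'd set" where
  "halves T X = {d \<in> darts T. colouring T (vertex_of T d) \<noteq> X}"

definition contact :: "'d tri_map \<Rightarrow> colour \<Rightarrow> 'd set set \<Rightarrow> ('d \<times> 'd) set" where
  "contact T X C = {(d, rot T d) | d. d \<in> halves T X} \<union>
     {(d, nxt T d) | d. d \<in> darts T \<and> edge_of T d \<in> edges_of_colour T X - C}"

definition separating :: "'d tri_map \<Rightarrow> colour \<Rightarrow> 'd set set \<Rightarrow> bool" where
  "separating T X C \<longleftrightarrow>
     (\<exists>a\<in>halves T X. \<exists>b\<in>halves T X. (a, b) \<notin> (contact T X C \<union> (contact T X C)\<inverse>)\<^sup>*)"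

text \<open>
  A cycle is identified with its set of arcs, so that it does not depend on the starting point.
\<close>

definition cycles_in :: "'d tri_map \<Rightarrow> colour \<Rightarrow> 'd set set \<Rightarrow> 'd set set set" where
  "cycles_in T X W = {set p | p. pre_digraph.cycle (dual_graph T X) p \<and> set p \<subseteq> W}"

definition wreath :: "'d tri_map \<Rightarrow> colour \<Rightarrow> 'd set set \<Rightarrow> bool" where
  "wreath T X W \<longleftrightarrow> W \<subseteq> arcs (dual_graph T X) \<and>
     (\<forall>v\<in>verts (dual_graph T X). \<exists>!e. e \<in> W \<and> head (dual_graph T X) e = v) \<and>
     (\<forall>C\<in>cycles_in T X W. \<not> separating T X C)"

definition states :: "'d tri_map \<Rightarrow> ('d set \<Rightarrow> 'd set) set" where
  "states T = {s \<in> extensional (white_triangles T).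
     bij_betw s (white_triangles T) (vertices T) \<and>
     (\<forall>f\<in>white_triangles T. s f \<in> vertex_of T ` f)}"

definition arrows :: "'d tri_map \<Rightarrow> colour \<Rightarrow> ('d set \<Rightarrow> 'd set) \<Rightarrow> 'd set set" where
  "arrows T X s = {e \<in> edges T. \<exists>f\<in>white_triangles T.
     colouring T (s f) = X \<and> f \<inter> e \<noteq> {} \<and> s f \<notin> vertex_of T ` e}"

end

theory Submission
  imports Defs
begin

text \<open>
  Cut the torus along the arcs of \<open>W\<close>.  A state extending \<open>W\<close> assigns every remaining edge of colour
  \<open>X\<close> to one of its ends so that each vertex of another colour is used once; given one such
  assignment, the others are obtained by reversing cycles of its functional graph, so there are
  \<open>2 ^ c\<close> of them, where \<open>c\<close> is the number of these cycles.

  An assignment exists unless some component of the remaining graph is a tree.  A tree has a single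
  boundary curve, which runs along only one side of one component of \<open>W\<close>, so that the cycle of that
  component would be separating.

  Finally \<open>c = k\<close>: the curves that separate a neighbourhood of \<open>W\<close> from a neighbourhood of the
  remaining graph do not distinguish the two graphs, and each component of a functional graph on an
  oriented surface has exactly two boundary curves.  These curves are counted by counting the sets of
  corners that are unions of them: modulo the sets constant on components, such a set is determined
  by the union of cycles across which it changes, and two-sidedness shows that every union of cycles
  occurs.
\<close>

section \<open>Permutations of finite sets\<close>

text \<open>Both graphs are read off one set of half-edges, the darts on edges of colour
  \<open>X\<close>. Each such edge is crossed by exactly one arc of \<open>G_X^*\<close>, so the
  edges of colour \<open>X\<close>, drawn on the vertices of the other two colours, form the dual of
  \<open>G_X^*\<close>, and \<open>W\<close> and the remaining edges are complementary subsets of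
  one edge set. This is why the boundary curves of the two graphs are literally the same. The
  obstacle is that \<open>c\<close> belongs to an assignment that must first be shown to exist, and
  that its cycles are not matched one by one with those of \<open>W\<close>. Only numbers are
  compared: for a functional graph with \<open>n\<close> cycles the unions of boundary curves form a
  vector space over the field with two elements, of size \<open>2 ^ n\<close> (possible changes)
  times \<open>2 ^ n\<close> (sets constant on components), so that equal squares give
  \<open>c = k\<close>. Euler characteristic 0 enters as a count: there are as many remaining edges
  as vertices of colour other than \<open>X\<close>. So if every vertex owns an edge of its own, no
  edge is left over.\<close>

lemma bij_betw_self_in_orbit:
  assumes "finite A" "bij_betw f A A" "x \<in> A"
  shows "x \<in> orbit f x"
proof -
  have 1: "perm_restrict f A permutes A"
    by (rule bij_imp_permutes) (use assms in \<open>auto simp: perm_restrict_def cong: bij_betw_cong\<close>)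
  have "orbit f x = orbit (perm_restrict f A) x"
    using assms by (intro orbit_cong0[where A=A]) (auto simp: perm_restrict_def bij_betw_def)
  then show ?thesis
    using 1 assms(1) permutation_permutes permutation_self_in_orbit by metis
qed

lemma orbit_subset_closed:
  assumes "\<And>x. x \<in> A \<Longrightarrow> f x \<in> A" "x \<in> A"
  shows "orbit f x \<subseteq> A"
proof
  fix y assume "y \<in> orbit f x" then show "y \<in> A" by induct (auto simp: assms)
qed

lemma orbit_eq_if_in:
  assumes "x \<in> orbit f x" "y \<in> orbit f x"
  shows "orbit f y = orbit f x"
  using assms by (meson orbit_swap orbit_trans subsetI subset_antisym)

lemma bij_betw_closed_subset:
  assumes "finite A" "bij_betw f A A" "P \<subseteq> A" "\<And>x. x \<in> P \<Longrightarrow> f x \<in> P"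
  shows "bij_betw f P P"
proof -
  have "inj_on f P" using assms by (meson bij_betw_def inj_on_subset)
  then show ?thesis
    using assms(1,3,4) endo_inj_surj[of P f] finite_subset[of P A] by (auto simp: bij_betw_def)
qed

lemma bij_betw_closed_iff:
  assumes "finite A" "bij_betw f A A" "P \<subseteq> A" "\<And>x. x \<in> P \<Longrightarrow> f x \<in> P" "x \<in> A"
  shows "f x \<in> P \<longleftrightarrow> x \<in> P"
proof
  assume "f x \<in> P"
  moreover have "f ` P = P" using bij_betw_closed_subset[OF assms(1-4)] by (auto simp: bij_betw_def)
  ultimately obtain y where "y \<in> P" "f x = f y" by auto
  then show "x \<in> P" using assms by (metis bij_betw_def inj_onD subsetD)
qed (use assms in auto)

text \<open>Along a permutation, entries into \<open>Q\<close> balance exits, because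
  \<open>f\<close> maps the points of \<open>P\<close> that are sent into \<open>Q\<close>
  bijectively onto the points of \<open>P\<close> in \<open>Q\<close>.\<close>

lemma even_card_changes:
  assumes "finite P" "bij_betw f P P"
  shows "even (card {x \<in> P. (x \<in> Q) \<noteq> (f x \<in> Q)})"
proof -
  have "bij_betw f {x \<in> P. f x \<in> Q} {x \<in> P. x \<in> Q}"
    using assms(2) by (auto simp: bij_betw_def inj_on_def image_iff)
  then have c: "card {x \<in> P. f x \<in> Q} = card {x \<in> P. x \<in> Q}" by (rule bij_betw_same_card)
  let ?a = "{x \<in> P. x \<in> Q \<and> f x \<in> Q}" and ?b = "{x \<in> P. x \<in> Q \<and> f x \<notin> Q}"
    and ?c = "{x \<in> P. x \<notin> Q \<and> f x \<in> Q}"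
  have "{x \<in> P. x \<in> Q} = ?a \<union> ?b" "{x \<in> P. f x \<in> Q} = ?a \<union> ?c" by auto
  then have "card ?a + card ?b = card {x \<in> P. x \<in> Q}" "card ?a + card ?c = card {x \<in> P. f x \<in> Q}"
    using assms(1) by (simp_all only:) (subst card_Un_disjoint; auto)+
  then have "card ?b = card ?c" using c by simp
  moreover have "{x \<in> P. (x \<in> Q) \<noteq> (f x \<in> Q)} = ?b \<union> ?c" by auto
  then have "card {x \<in> P. (x \<in> Q) \<noteq> (f x \<in> Q)} = card ?b + card ?c"
    using assms(1) by (simp_all only:) (subst card_Un_disjoint; auto)+
  ultimately show ?thesis by simp
qed

lemma even_card_involution:
  assumes "finite Z" "\<And>x. x \<in> Z \<Longrightarrow> f x \<in> Z" "\<And>x. x \<in> Z \<Longrightarrow> f (f x) = x" "\<And>x. x \<in> Z \<Longrightarrow> f x \<noteq> x"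
  shows "even (card Z)"
  using assms
proof (induction Z rule: finite_psubset_induct)
  case (psubset Z)
  show ?case
  proof (cases "Z = {}")
    case False
    then obtain x where x: "x \<in> Z" by auto
    have "even (card (Z - {x, f x}))"
      using psubset.prems x by (intro psubset.IH) (auto; metis)+
    moreover have "card Z = card (Z - {x, f x}) + 2"
    proof -
      have "card {x, f x} = 2" using psubset.prems(3)[OF x] by (simp add: eq_commute)
      moreover have "{x, f x} \<subseteq> Z" using psubset.prems x by auto
      ultimately show ?thesis
        using psubset.hyps by (metis card_Diff_subset card_mono finite_subset le_add_diff_inverse2)
    qed
    ultimately show ?thesis by simp
  qed simp
qed

section \<open>Finite functional graphs\<close>

text \<open>With \<open>g\<close> read as a functional graph on a finite \<open>I\<close>, these are
  the unions of its cycles.\<close>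

definition stable_sets :: "('a \<Rightarrow> 'a) \<Rightarrow> 'a set \<Rightarrow> 'a set set" where
  "stable_sets g I = {D. D \<subseteq> I \<and> g ` D = D}"

text \<open>The unions of connected components of the functional graph.\<close>

definition invariant_sets :: "('a \<Rightarrow> 'a) \<Rightarrow> 'a set \<Rightarrow> 'a set set" where
  "invariant_sets g I = {R. R \<subseteq> I \<and> (\<forall>i\<in>I. g i \<in> R \<longleftrightarrow> i \<in> R)}"

text \<open>The single cycles. An \<open>orbit\<close> contains only the iterates of order at least
  one, so \<open>x \<in> orbit g x\<close> singles out the periodic points.\<close>

definition cyclic_orbits :: "('a \<Rightarrow> 'a) \<Rightarrow> 'a set \<Rightarrow> 'a set set" where
  "cyclic_orbits g I = {orbit g x | x. x \<in> I \<and> x \<in> orbit g x}"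

text \<open>A finite set has no fewer elements than its image, so this inclusion is already an
  equality.\<close>

lemma stable_setsI:
  assumes "finite I" "D \<subseteq> I" "D \<subseteq> g ` D"
  shows "D \<in> stable_sets g I"
proof -
  have "finite D" using assms finite_subset by auto
  then have "D = g ` D" using assms by (meson card_image_le card_seteq finite_imageI)
  then show ?thesis using assms by (auto simp: stable_sets_def)
qed

lemma stable_sets_bij_betw:
  assumes "finite I" "D \<in> stable_sets g I"
  shows "bij_betw g D D"
  using assms finite_surj_inj[of D g] by (auto simp: stable_sets_def bij_betw_def finite_subset)

lemma funpow_closed:
  assumes "g ` I \<subseteq> I" "x \<in> I" shows "(g ^^ n) x \<in> I"
  using assms by (induct n) auto

text \<open>By the pigeonhole principle two iterates agree, and a point that recurs lies on a
  cycle.\<close>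

lemma eventually_cyclic:
  assumes "finite I" "g ` I \<subseteq> I" "x \<in> I"
  shows "\<exists>n. (g ^^ n) x \<in> orbit g ((g ^^ n) x)"
proof -
  have "range (\<lambda>n. (g ^^ n) x) \<subseteq> I" using funpow_closed[OF assms(2,3)] by auto
  then have "\<not> inj (\<lambda>n. (g ^^ n) x)"
    using assms(1) finite_imageD finite_subset infinite_UNIV_nat by blast
  then obtain m n where "m \<noteq> n" "(g ^^ m) x = (g ^^ n) x" by (auto simp: inj_def)
  then have "\<exists>m n. m < n \<and> (g ^^ m) x = (g ^^ n) x" by (metis nat_neq_iff)
  then obtain m n where mn: "m < n" "(g ^^ m) x = (g ^^ n) x" by blast
  then have "(g ^^ (n - m)) ((g ^^ m) x) = (g ^^ m) x"
    by (metis funpow_add le_add_diff_inverse2 less_imp_le o_apply)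
  then have "(g ^^ m) x \<in> orbit g ((g ^^ m) x)"
    unfolding orbit_altdef using mn(1) by (metis (mono_tags, lifting) mem_Collect_eq zero_less_diff)
  then show ?thesis by blast
qed

lemma cyclic_orbit_stable:
  assumes "g ` I \<subseteq> I" "x \<in> I" "x \<in> orbit g x"
  shows "orbit g x \<subseteq> I" "g ` orbit g x = orbit g x"
proof -
  show "orbit g x \<subseteq> I" using assms by (intro orbit_subset_closed) auto
  show "g ` orbit g x = orbit g x"
  proof
    show "orbit g x \<subseteq> g ` orbit g x"
    proof
      fix y assume "y \<in> orbit g x"
      then show "y \<in> g ` orbit g x" by cases (use assms in auto)
    qed
  qed (auto intro: orbit.step)
qed

lemma stable_sets_cyclic:
  assumes "finite I" "D \<in> stable_sets g I" "x \<in> D"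
  shows "x \<in> orbit g x" "orbit g x \<subseteq> D"
proof -
  show "x \<in> orbit g x"
    using bij_betw_self_in_orbit[OF _ stable_sets_bij_betw[OF assms(1,2)] assms(3)] assms
    by (auto simp: stable_sets_def finite_subset)
  show "orbit g x \<subseteq> D" using assms by (intro orbit_subset_closed) (auto simp: stable_sets_def)
qed

text \<open>Cycles are pairwise disjoint, so a union of cycles determines which cycles it contains,
  and \<open>\<Union>\<close> is a bijection from the sets of cycles.\<close>

lemma card_stable_sets:
  assumes "finite I" "g ` I \<subseteq> I"
  shows "card (stable_sets g I) = 2 ^ card (cyclic_orbits g I)"
proof -
  have disj: "O1 = O2" if O12: "O1 \<in> cyclic_orbits g I" "O2 \<in> cyclic_orbits g I" "x \<in> O1" "x \<in> O2" for O1 O2 x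
  proof -
    obtain a b where "a \<in> orbit g a" "O1 = orbit g a" "b \<in> orbit g b" "O2 = orbit g b"
      using O12(1,2) by (auto simp: cyclic_orbits_def)
    then show ?thesis using O12(3,4) orbit_eq_if_in by metis
  qed
  have "bij_betw \<Union> (Pow (cyclic_orbits g I)) (stable_sets g I)"
  proof (intro bij_betw_imageI inj_onI set_eqI iffI)
    fix F F' O1 assume F: "F \<in> Pow (cyclic_orbits g I)" "F' \<in> Pow (cyclic_orbits g I)" "\<Union>F = \<Union>F'"
    { fix F F' O1 assume F: "F \<in> Pow (cyclic_orbits g I)" "F' \<in> Pow (cyclic_orbits g I)" "\<Union>F = \<Union>F'" "O1 \<in> F"
      then obtain x where "x \<in> O1" by (auto simp: cyclic_orbits_def)
      then have "x \<in> \<Union>F'" using F(3,4) by blast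
      then obtain O2 where "O2 \<in> F'" "x \<in> O2" by auto
      then have "O1 \<in> F'" using disj F \<open>x \<in> O1\<close> by (metis PowD subsetD) }
    with F show "O1 \<in> F \<Longrightarrow> O1 \<in> F'" "O1 \<in> F' \<Longrightarrow> O1 \<in> F" by metis+
  next
    fix D assume "D \<in> \<Union> ` Pow (cyclic_orbits g I)"
    then obtain F where F: "F \<subseteq> cyclic_orbits g I" "D = \<Union>F" by auto
    have "O1 \<subseteq> I \<and> g ` O1 = O1" if O1: "O1 \<in> F" for O1
    proof -
      obtain x where "x \<in> I" "x \<in> orbit g x" "O1 = orbit g x"
        using F(1) O1 by (auto simp: cyclic_orbits_def)
      then show ?thesis using cyclic_orbit_stable[OF assms(2)] by simp
    qed
    then show "D \<in> stable_sets g I" using F by (auto simp: stable_sets_def image_Union)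
  next
    fix D assume D: "D \<in> stable_sets g I"
    have "D = \<Union> (orbit g ` D)" using stable_sets_cyclic[OF assms(1) D] by auto
    moreover have "orbit g ` D \<subseteq> cyclic_orbits g I"
      using stable_sets_cyclic[OF assms(1) D] D by (auto simp: cyclic_orbits_def stable_sets_def)
    ultimately show "D \<in> \<Union> ` Pow (cyclic_orbits g I)" by blast
  qed
  then have "card (stable_sets g I) = card (Pow (cyclic_orbits g I))"
    by (rule bij_betw_same_card[symmetric])
  moreover have "cyclic_orbits g I \<subseteq> orbit g ` I" by (auto simp: cyclic_orbits_def)
  then have "finite (cyclic_orbits g I)" using assms(1) finite_subset by blast
  ultimately show ?thesis by (simp add: card_Pow)
qed

lemma invariant_sets_funpow:
  assumes "g ` I \<subseteq> I" "R \<in> invariant_sets g I" "x \<in> I"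
  shows "(g ^^ n) x \<in> R \<longleftrightarrow> x \<in> R"
  using assms funpow_closed[OF assms(1,3)]
  by (induct n) (auto simp: invariant_sets_def)

text \<open>Passes from a union of cycles to the components that contain them: a path enters
  \<open>D\<close> from \<open>i\<close> exactly when it does so from \<open>g i\<close>, as
  \<open>D\<close> is never left again.\<close>

lemma stable_preimage_invariant:
  assumes "g ` I \<subseteq> I" "D \<in> stable_sets g I"
  shows "{x \<in> I. \<exists>n. (g ^^ n) x \<in> D} \<in> invariant_sets g I" (is "?R \<in> _")
proof -
  have "g i \<in> ?R \<longleftrightarrow> i \<in> ?R" if i: "i \<in> I" for i
  proof
    assume "g i \<in> ?R"
    then obtain n where "(g ^^ n) (g i) \<in> D" by auto
    then have "(g ^^ Suc n) i \<in> D" by (simp only: funpow_Suc_right o_apply)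
    then show "i \<in> ?R" using i by blast
  next
    assume "i \<in> ?R"
    then obtain n where "(g ^^ n) i \<in> D" by auto
    then have "g ((g ^^ n) i) \<in> D" using assms(2) by (auto simp: stable_sets_def)
    then have "(g ^^ n) (g i) \<in> D" by (simp only: funpow_swap1)
    then show "g i \<in> ?R" using i assms(1) by blast
  qed
  then show ?thesis by (auto simp: invariant_sets_def)
qed

lemma stable_if_cyclic_preimage:
  assumes "finite I" "D \<in> stable_sets g I" "x \<in> orbit g x" "(g ^^ n) x \<in> D"
  shows "x \<in> D"
proof -
  have "(g ^^ n) x \<in> orbit g x" using assms(3) funpow_in_orbit by fast
  then have "x \<in> orbit g ((g ^^ n) x)" using assms(3) orbit_swap by fast
  then show "x \<in> D" using stable_sets_cyclic(2)[OF assms(1,2,4)] by auto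
qed

text \<open>Each component of a finite functional graph contains exactly one cycle, so a union of
  components is recovered from its periodic points.\<close>

lemma card_invariant_sets:
  assumes "finite I" "g ` I \<subseteq> I"
  shows "card (invariant_sets g I) = card (stable_sets g I)"
proof (rule bij_betw_same_card[of "\<lambda>R. {x \<in> R. x \<in> orbit g x}"],
    intro bij_betw_imageI inj_onI set_eqI iffI)
  fix R R' x
  assume R: "R \<in> invariant_sets g I" "R' \<in> invariant_sets g I"
    "{x \<in> R. x \<in> orbit g x} = {x \<in> R'. x \<in> orbit g x}"
  { fix x assume "x \<in> I"
    then obtain n where "(g ^^ n) x \<in> orbit g ((g ^^ n) x)" using eventually_cyclic assms by metis
    then have "(g ^^ n) x \<in> R \<longleftrightarrow> (g ^^ n) x \<in> R'" using R(3) by auto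
    then have "x \<in> R \<longleftrightarrow> x \<in> R'" using invariant_sets_funpow assms(2) R(1,2) \<open>x \<in> I\<close> by metis }
  then show "x \<in> R \<Longrightarrow> x \<in> R'" "x \<in> R' \<Longrightarrow> x \<in> R" using R(1,2) by (auto simp: invariant_sets_def)
next
  fix D assume "D \<in> (\<lambda>R. {x \<in> R. x \<in> orbit g x}) ` invariant_sets g I"
  then obtain R where R: "R \<in> invariant_sets g I" "D = {x \<in> R. x \<in> orbit g x}" by auto
  have "D \<subseteq> g ` D"
  proof
    fix x assume x: "x \<in> D"
    then have "x \<in> I" using R by (auto simp: invariant_sets_def)
    then obtain y where y: "y \<in> orbit g x" "x = g y"
      using cyclic_orbit_stable(2)[OF assms(2)] x R(2) by blast
    have "y \<in> I" using y cyclic_orbit_stable(1)[OF assms(2) \<open>x \<in> I\<close>] x R(2) by auto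
    then have "y \<in> R" using x y R by (auto simp: invariant_sets_def)
    moreover have "y \<in> orbit g y" using x y R self_in_orbit_trans by fast
    ultimately show "x \<in> g ` D" using y R by auto
  qed
  then show "D \<in> stable_sets g I" using R assms by (intro stable_setsI) (auto simp: invariant_sets_def)
next
  fix D assume D: "D \<in> stable_sets g I"
  let ?R = "{x \<in> I. \<exists>n. (g ^^ n) x \<in> D}"
  have "?R \<in> invariant_sets g I" by (rule stable_preimage_invariant[OF assms(2) D])
  moreover have "D = {x \<in> ?R. x \<in> orbit g x}"
  proof (intro set_eqI iffI)
    fix x assume "x \<in> D"
    then show "x \<in> {x \<in> ?R. x \<in> orbit g x}"
      using stable_sets_cyclic[OF assms(1) D] D by (auto simp: stable_sets_def intro: exI[of _ 0])
  next
    fix x assume x: "x \<in> {x \<in> ?R. x \<in> orbit g x}"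
    then obtain n where n: "(g ^^ n) x \<in> D" by auto
    show "x \<in> D" using stable_if_cyclic_preimage[OF assms(1) D _ n] x by auto
  qed
  ultimately show "D \<in> (\<lambda>R. {x \<in> R. x \<in> orbit g x}) ` invariant_sets g I" by blast
qed

section \<open>Ribbon graphs\<close>

text \<open>
  A graph on an oriented surface given by its half-edges: the orbits of \<open>\<tau>\<close> are the vertices, those
  of \<open>\<phi>\<close> the edges and those of \<open>\<tau> \<circ> \<phi>\<close> the faces.
\<close>

locale ribbon_map =
  fixes A :: "'a set" and \<tau> \<phi> :: "'a \<Rightarrow> 'a"
  assumes finite_A: "finite A"
    and bij_\<tau>: "bij_betw \<tau> A A"
    and \<phi>_in: "d \<in> A \<Longrightarrow> \<phi> d \<in> A"
    and \<phi>_\<phi>: "d \<in> A \<Longrightarrow> \<phi> (\<phi> d) = d"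
    and \<phi>_neq: "d \<in> A \<Longrightarrow> \<phi> d \<noteq> d"
begin

lemma \<tau>_in: "d \<in> A \<Longrightarrow> \<tau> d \<in> A"
  using bij_\<tau> by (auto simp: bij_betw_def)

lemma bij_\<phi>: "bij_betw \<phi> A A"
  by (rule bij_betwI[of \<phi> A A \<phi>]) (auto simp: \<phi>_in \<phi>_\<phi>)

lemma self_orbit: "d \<in> A \<Longrightarrow> d \<in> orbit \<tau> d"
  using bij_betw_self_in_orbit[OF finite_A bij_\<tau>] .

lemma orbit_in: "d \<in> A \<Longrightarrow> orbit \<tau> d \<subseteq> A"
  by (rule orbit_subset_closed) (auto simp: \<tau>_in)

lemma orbit_eq: "d \<in> A \<Longrightarrow> e \<in> orbit \<tau> d \<Longrightarrow> orbit \<tau> e = orbit \<tau> d"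
  by (simp add: orbit_eq_if_in self_orbit)

text \<open>Vertices and faces change places while half-edges and edges stay. This is how
  \<open>G_X^*\<close> and the graph of the edges of colour \<open>X\<close> are treated by the same
  lemmas.\<close>

lemma dual: "ribbon_map A (\<tau> \<circ> \<phi>) \<phi>"
  by unfold_locales
    (auto simp: finite_A \<phi>_in \<phi>_\<phi> \<phi>_neq intro!: bij_betw_trans[OF bij_\<phi> bij_\<tau>])

text \<open>
  The boundary curves between a neighbourhood of the edges in \<open>S\<close> and its complement are the orbits
  of the permutation that follows an edge of \<open>S\<close> and skips all other edges.
\<close>

definition boundary_unions :: "'a set \<Rightarrow> 'a set set" where
  "boundary_unions S = {Q. Q \<subseteq> A \<and>
     (\<forall>d\<in>A. (if d \<in> S then \<tau> (\<phi> d) else \<tau> d) \<in> Q \<longleftrightarrow> d \<in> Q)}"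

text \<open>Equivalently, the ways to orient the edges of \<open>S\<close> such that each vertex is
  the head of exactly one of them; \<open>j \<in> J\<close> lies at the head.\<close>

definition transversals :: "'a set \<Rightarrow> 'a set set" where
  "transversals S = {J. J \<subseteq> S \<and> (\<forall>d\<in>S. d \<in> J \<longleftrightarrow> \<phi> d \<notin> J) \<and> (\<forall>d\<in>A. \<exists>!j. j \<in> J \<and> j \<in> orbit \<tau> d)}"

text \<open>A half-edge also names the corner just before it in the rotation. So \<open>d\<close>
  and \<open>\<tau> d\<close> are the corners on either side of the half-edge \<open>d\<close>, and
  \<open>Q\<close> is a set of corners.\<close>

definition changes :: "'a set \<Rightarrow> 'a set" where
  "changes Q = {d \<in> A. (d \<in> Q) \<noteq> (\<tau> d \<in> Q)}"

end

text \<open>Outside \<open>S\<close> the dual rule yields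
  \<open>\<tau> (\<phi> (\<phi> d)) = \<tau> d\<close>, so both sides refer to one and the same
  permutation.\<close>

lemma (in ribbon_map) boundary_unions_dual:
  "ribbon_map.boundary_unions A (\<tau> \<circ> \<phi>) \<phi> (A - S) = boundary_unions S"
proof -
  interpret dual: ribbon_map A "\<tau> \<circ> \<phi>" \<phi> by (rule dual)
  show ?thesis
    unfolding dual.boundary_unions_def boundary_unions_def by (auto simp: \<phi>_\<phi>)
qed

text \<open>
  Every vertex owns exactly one edge of \<open>S\<close>, and \<open>I\<close> consists of the half-edges at the owners; thus
  \<open>S\<close> is a functional graph, with \<open>par\<close> leading to the edge owned by the other end.
\<close>

locale rooted_ribbon = ribbon_map +
  fixes S I :: "'a set"
  assumes S_in: "S \<subseteq> A"
    and \<phi>_S: "d \<in> S \<Longrightarrow> \<phi> d \<in> S"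
    and I_transversal: "I \<in> transversals S"
begin

lemma I_S: "I \<subseteq> S" and I_\<phi>: "d \<in> S \<Longrightarrow> d \<in> I \<longleftrightarrow> \<phi> d \<notin> I"
  and ex1_I: "d \<in> A \<Longrightarrow> \<exists>!i. i \<in> I \<and> i \<in> orbit \<tau> d"
  using I_transversal by (auto simp: transversals_def)

lemma I_A: "I \<subseteq> A" using I_S S_in by auto

lemma finite_I: "finite I" using I_A finite_A finite_subset by auto

definition root :: "'a \<Rightarrow> 'a" where "root d = (THE i. i \<in> I \<and> i \<in> orbit \<tau> d)"

definition par :: "'a \<Rightarrow> 'a" where "par i = root (\<phi> i)"

lemma root_in: "d \<in> A \<Longrightarrow> root d \<in> I" and root_orbit: "d \<in> A \<Longrightarrow> root d \<in> orbit \<tau> d"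
  using theI'[OF ex1_I] by (auto simp: root_def)

lemma root_eqI: "d \<in> A \<Longrightarrow> i \<in> I \<Longrightarrow> i \<in> orbit \<tau> d \<Longrightarrow> root d = i"
  using ex1_I root_in root_orbit by blast

lemma root_I: "i \<in> I \<Longrightarrow> root i = i"
  using I_A self_orbit by (auto intro: root_eqI)

lemma root_cong: "d \<in> A \<Longrightarrow> e \<in> orbit \<tau> d \<Longrightarrow> root e = root d"
  using orbit_eq by (simp add: root_def)

lemma root_\<tau>: "d \<in> A \<Longrightarrow> root (\<tau> d) = root d"
  by (rule root_cong) (auto intro: orbit.base)

lemma par_in: "i \<in> I \<Longrightarrow> par i \<in> I"
  using I_A \<phi>_in root_in by (auto simp: par_def)

lemma par_image: "par ` I \<subseteq> I" using par_in by auto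

lemma in_orbit_root: "d \<in> A \<Longrightarrow> d \<in> orbit \<tau> (root d)"
  using orbit_swap root_orbit self_orbit by fast

lemma changes_S:
  assumes "Q \<in> boundary_unions S"
  shows "changes Q \<subseteq> S"
proof
  fix d assume d: "d \<in> changes Q"
  then have "d \<in> A" by (simp add: changes_def)
  then have "(if d \<in> S then \<tau> (\<phi> d) else \<tau> d) \<in> Q \<longleftrightarrow> d \<in> Q"
    using assms by (simp add: boundary_unions_def)
  then show "d \<in> S" using d by (cases "d \<in> S") (simp_all add: changes_def)
qed

text \<open>The two sides of an edge in \<open>S\<close> are followed by boundary curves: corner
  \<open>d\<close> continues to \<open>\<tau> (\<phi> d)\<close>, and corner \<open>\<phi> d\<close>
  to \<open>\<tau> d\<close>. Hence the same pair of sides is compared at both ends.\<close>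

lemma changes_\<phi>:
  assumes "Q \<in> boundary_unions S" "d \<in> S"
  shows "\<phi> d \<in> changes Q \<longleftrightarrow> d \<in> changes Q"
proof -
  have "d \<in> A" "\<phi> d \<in> S" "\<phi> d \<in> A" using assms S_in \<phi>_S \<phi>_in by auto
  then have "\<tau> (\<phi> d) \<in> Q \<longleftrightarrow> d \<in> Q" "\<tau> (\<phi> (\<phi> d)) \<in> Q \<longleftrightarrow> \<phi> d \<in> Q"
    using assms unfolding boundary_unions_def by (auto split: if_splits)
  then show ?thesis using \<open>d \<in> A\<close> \<open>\<phi> d \<in> A\<close> by (auto simp: changes_def \<phi>_\<phi>)
qed

text \<open>An even subgraph of a functional graph is a union of cycles. By parity, the vertex
  owning an edge of \<open>Z\<close> has a second half-edge in \<open>Z\<close>; it is not in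
  \<open>I\<close>, so it is the far end of an edge in \<open>Z\<close> that \<open>par\<close>
  sends to the given one.\<close>

lemma stable_if_even:
  assumes Z: "Z \<subseteq> S" "\<And>d. d \<in> Z \<Longrightarrow> \<phi> d \<in> Z" "\<And>i. i \<in> I \<Longrightarrow> even (card (Z \<inter> orbit \<tau> i))"
  shows "Z \<inter> I \<in> stable_sets par I"
proof (rule stable_setsI[OF finite_I])
  show "Z \<inter> I \<subseteq> par ` (Z \<inter> I)"
  proof
    fix i assume i: "i \<in> Z \<inter> I"
    then have iA: "i \<in> A" using I_A by auto
    have "Z \<inter> orbit \<tau> i \<noteq> {i}" using Z(3)[of i] i by auto
    moreover have "i \<in> Z \<inter> orbit \<tau> i" using i self_orbit[OF iA] by auto
    ultimately obtain d where d: "d \<in> Z" "d \<in> orbit \<tau> i" "d \<noteq> i" by auto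
    have "d \<notin> I" using d ex1_I[OF iA] i self_orbit[OF iA] by blast
    moreover have "d \<in> S" using d Z by auto
    ultimately have "\<phi> d \<in> I" using I_\<phi> by auto
    moreover have "\<phi> d \<in> Z" using d Z by auto
    moreover have "par (\<phi> d) = i"
      using root_cong[OF iA d(2)] root_I i \<open>d \<in> S\<close> S_in by (auto simp: par_def \<phi>_\<phi>)
    ultimately show "i \<in> par ` (Z \<inter> I)" by (metis IntI imageI)
  qed
qed auto

lemma even_changes_orbit:
  assumes "i \<in> A" shows "even (card (changes Q \<inter> orbit \<tau> i))"
proof -
  have "changes Q \<inter> orbit \<tau> i = {d \<in> orbit \<tau> i. (d \<in> Q) \<noteq> (\<tau> d \<in> Q)}"
    using orbit_in[OF assms] by (auto simp: changes_def)
  moreover have "bij_betw \<tau> (orbit \<tau> i) (orbit \<tau> i)"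
    by (rule bij_betw_closed_subset[OF finite_A bij_\<tau> orbit_in[OF assms]]) (rule orbit.step)
  moreover have "finite (orbit \<tau> i)" using orbit_in[OF assms] finite_A finite_subset by auto
  ultimately show ?thesis by (simp only: even_card_changes)
qed

lemma changes_stable:
  assumes "Q \<in> boundary_unions S"
  shows "changes Q \<inter> I \<in> stable_sets par I"
  using changes_S[OF assms] changes_\<phi>[OF assms] I_A even_changes_orbit
  by (intro stable_if_even) auto

text \<open>This is where orientability enters: cycles are two-sided.\<close>

lemma ex_side:
  assumes D: "D \<in> stable_sets par I"
  shows "\<exists>Q \<in> boundary_unions S. changes Q \<inter> I = D"
proof -
  have DI: "D \<subseteq> I" "par ` D = D" using D by (auto simp: stable_sets_def)
  have inj: "inj_on par D" using stable_sets_bij_betw[OF finite_I D] by (auto simp: bij_betw_def)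
  \<comment> \<open>The predecessor on the cycle: the cycle passes the vertex of \<open>i\<close>
    through exactly the half-edges \<open>i\<close> and \<open>\<phi> (chi i)\<close>.\<close>
  define chi where "chi i = inv_into D par i" for i
  have chi: "chi i \<in> D" "par (chi i) = i" if "i \<in> D" for i
    using that DI by (auto simp: chi_def inv_into_into f_inv_into_f)
  have chi_orb: "\<phi> (chi i) \<in> orbit \<tau> i" "\<phi> (chi i) \<in> A" "\<phi> (chi i) \<notin> I" if "i \<in> D" for i
  proof -
    have "chi i \<in> A" using chi(1)[OF that] DI I_A by auto
    then show 1: "\<phi> (chi i) \<in> A" by (rule \<phi>_in)
    show "\<phi> (chi i) \<in> orbit \<tau> i" using in_orbit_root[OF 1] chi(2)[OF that] by (simp add: par_def)
    show "\<phi> (chi i) \<notin> I" using chi(1)[OF that] DI I_S I_\<phi> by blast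
  qed
  \<comment> \<open>For \<open>root d \<in> D\<close>, the two half-edges of the cycle at the vertex
    of \<open>d\<close>. They differ even if the cycle is a loop, as only one of them is in
    \<open>I\<close>.\<close>
  define ends where "ends d = {root d, \<phi> (chi (root d))}" for d
  define steps where "steps d = (LEAST n. (\<tau> ^^ n) d \<in> ends d)" for d
  \<comment> \<open>\<open>near d\<close>: turning around the vertex from \<open>d\<close>, the half-edge in \<open>I\<close> is the first one of \<open>D\<close> to be met.\<close>
  define near where "near d \<longleftrightarrow> d \<in> A \<and> root d \<in> D \<and> (\<tau> ^^ steps d) d \<in> I" for d
  have ex_steps: "\<exists>n. (\<tau> ^^ n) d \<in> ends d" if "d \<in> A" for d
    using root_orbit[OF that] by (auto simp: orbit_altdef ends_def)
  have ends_\<tau>: "ends (\<tau> d) = ends d" if "d \<in> A" for d using root_\<tau>[OF that] by (simp add: ends_def)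
  have near_ends: "near d \<longleftrightarrow> d \<in> I" if "d \<in> A" "root d \<in> D" "d \<in> ends d" for d
  proof -
    have "steps d = 0" unfolding steps_def using that by (intro Least_eq_0) auto
    then show ?thesis using that by (auto simp: near_def)
  qed
  have near_step: "near (\<tau> d) \<longleftrightarrow> near d" if d: "d \<in> A" and e: "root d \<in> D \<Longrightarrow> d \<notin> ends d" for d
  proof (cases "root d \<in> D")
    case True
    obtain n where n: "(\<tau> ^^ n) d \<in> ends d" using ex_steps[OF d] by auto
    have "steps d = Suc (LEAST n. (\<tau> ^^ Suc n) d \<in> ends d)"
      unfolding steps_def using n e[OF True] by (intro Least_Suc) auto
    then have "steps d = Suc (steps (\<tau> d))"
      using ends_\<tau>[OF d] unfolding steps_def by (simp only: funpow_Suc_right o_apply)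
    then have "(\<tau> ^^ steps d) d = (\<tau> ^^ steps (\<tau> d)) (\<tau> d)" by (simp only: funpow_Suc_right o_apply)
    then show ?thesis using root_\<tau>[OF d] d \<tau>_in by (simp add: near_def)
  next
    case False
    then show ?thesis using root_\<tau>[OF d] by (simp add: near_def)
  qed
  have near_after: "near (\<tau> d) \<longleftrightarrow> d \<notin> I" if d: "d \<in> A" "root d \<in> D" "d \<in> ends d" for d
  proof -
    let ?o = "if d = root d then \<phi> (chi (root d)) else root d"
    have "\<exists>n. (\<tau> ^^ n) (\<tau> d) \<in> ends d" using ex_steps[OF \<tau>_in[OF d(1)]] ends_\<tau>[OF d(1)] by auto
    then have 1: "(\<tau> ^^ steps (\<tau> d)) (\<tau> d) \<in> ends d"
      unfolding steps_def ends_\<tau>[OF d(1)] by (rule LeastI_ex)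
    have neq: "root d \<noteq> \<phi> (chi (root d))" using chi_orb(3)[OF d(2)] root_in[OF d(1)] by metis
    \<comment> \<open>Coming back to \<open>d\<close> takes a full turn around the vertex, which
      would have met the other end \<open>?o\<close> earlier, against the minimality of
      \<open>steps\<close>.\<close>
    have 2: "(\<tau> ^^ steps (\<tau> d)) (\<tau> d) \<noteq> d"
    proof
      assume a: "(\<tau> ^^ steps (\<tau> d)) (\<tau> d) = d"
      let ?m = "steps (\<tau> d)"
      have per: "(\<tau> ^^ Suc ?m) d = d" using a by (simp only: funpow_Suc_right o_apply)
      have "\<phi> (chi (root d)) \<in> orbit \<tau> d"
        using chi_orb(1)[OF d(2)] unfolding orbit_eq[OF d(1) root_orbit[OF d(1)]] .
      then have "?o \<in> orbit \<tau> d" using root_orbit[OF d(1)] by presburger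
      also have "orbit \<tau> d = {(\<tau> ^^ n) d |n. n < Suc ?m}" using orbit_altdef_bounded[OF per] by simp
      finally obtain n where n: "?o = (\<tau> ^^ n) d" "n < Suc ?m" by blast
      have "?o \<noteq> d" using d(3) neq by (auto simp: ends_def split: if_splits)
      then have "n \<noteq> 0" using n by (intro notI) simp
      then obtain n' where n': "n = Suc n'" using not0_implies_Suc by blast
      have "(\<tau> ^^ n') (\<tau> d) \<in> ends (\<tau> d)"
        using n(1) n' ends_\<tau>[OF d(1)] by (simp only: funpow_Suc_right o_apply) (auto simp: ends_def split: if_splits)
      then have "steps (\<tau> d) \<le> n'" unfolding steps_def by (rule Least_le)
      then show False using n n' by simp
    qed
    have "near (\<tau> d) \<longleftrightarrow> (\<tau> ^^ steps (\<tau> d)) (\<tau> d) \<in> I"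
      using d \<tau>_in root_\<tau> by (simp add: near_def)
    then show ?thesis using 1 2 d(3) root_in[OF d(1)] chi_orb(3)[OF d(2)] neq by (auto simp: ends_def)
  qed
  \<comment> \<open>The corners \<open>j\<close> and \<open>\<tau> (\<phi> j)\<close> lie along one
    side of the edge and are both near; \<open>\<phi> j\<close> and \<open>\<tau> j\<close> lie
    along the other side and are both not near. So the sides do not get exchanged on the way around
    the cycle.\<close>
  have near_D: "near j" "\<not> near (\<phi> j)" "\<not> near (\<tau> j)" "near (\<tau> (\<phi> j))" if j: "j \<in> D" for j
  proof -
    have jA: "j \<in> A" "j \<in> I" and rj: "root j = j" using j DI I_A root_I by auto
    have p: "par j \<in> D" using j DI by auto
    have "chi (par j) = j" using inj j by (simp add: chi_def)
    then have e: "\<phi> j \<in> ends (\<phi> j)" by (simp add: ends_def par_def)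
    have \<phi>j: "\<phi> j \<in> A" "root (\<phi> j) \<in> D" "\<phi> j \<notin> I"
      using jA(1) \<phi>_in p jA(2) I_S I_\<phi> by (auto simp: par_def)
    show "near j" "\<not> near (\<tau> j)" using near_ends[of j] near_after[of j] jA rj j by (auto simp: ends_def)
    show "\<not> near (\<phi> j)" "near (\<tau> (\<phi> j))" using near_ends[of "\<phi> j"] near_after[of "\<phi> j"] \<phi>j e by auto
  qed
  have near_I: "near (\<tau> j) \<longleftrightarrow> near j" if j: "j \<in> A" "j \<notin> D" "\<phi> j \<notin> D" for j
  proof (rule near_step[OF j(1)])
    assume r: "root j \<in> D"
    show "j \<notin> ends j"
    proof
      assume "j \<in> ends j"
      then have "j = root j \<or> j = \<phi> (chi (root j))" by (auto simp: ends_def)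
      then show False
      proof
        assume "j = \<phi> (chi (root j))"
        then have "\<phi> j = chi (root j)" using chi(1)[OF r] DI I_A by (metis \<phi>_\<phi> subsetD)
        then show False using chi(1)[OF r] j by simp
      qed (use r j in auto)
    qed
  qed
  have near_not: "\<not> near d" if "root d \<notin> D" for d using that by (simp add: near_def)
  \<comment> \<open>\<open>late i\<close>: the branch through \<open>i\<close> leaves the cycles of \<open>D\<close> on the near side.\<close>
  define late where "late i \<longleftrightarrow> (\<exists>m. (par ^^ m) i \<notin> D \<and> (par ^^ Suc m) i \<in> D \<and> near (\<phi> ((par ^^ m) i)))" for i
  have D_pow: "(par ^^ m) i \<in> D" if "i \<in> D" for i m using that DI by (induct m) auto
  have late_D: "\<not> late i" if "i \<in> D" for i using D_pow[OF that] by (auto simp: late_def)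
  have late_par: "late i \<longleftrightarrow> (if par i \<in> D then near (\<phi> i) else late (par i))" if "i \<notin> D" for i
  proof (cases "par i \<in> D")
    case True
    have "late i \<longleftrightarrow> near (\<phi> i)"
    proof
      assume "late i"
      then obtain m where m: "(par ^^ m) i \<notin> D" "near (\<phi> ((par ^^ m) i))" by (auto simp: late_def)
      have "m = 0"
      proof (rule ccontr)
        assume "m \<noteq> 0"
        then obtain n where "m = Suc n" using not0_implies_Suc by blast
        then have "(par ^^ m) i = (par ^^ n) (par i)" by (simp only: funpow_Suc_right o_apply)
        then show False using m D_pow[OF True] by simp
      qed
      then show "near (\<phi> i)" using m by simp
    qed (use that True in \<open>auto simp: late_def intro: exI[of _ 0]\<close>)
    then show ?thesis using True by simp
  next
    case False
    have "late i \<longleftrightarrow> late (par i)"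
    proof
      assume "late i"
      then obtain m where m: "(par ^^ m) i \<notin> D" "(par ^^ Suc m) i \<in> D" "near (\<phi> ((par ^^ m) i))" by (auto simp: late_def)
      then have "m \<noteq> 0" using False by (intro notI) simp
      then obtain n where "m = Suc n" using not0_implies_Suc by blast
      then have "(par ^^ m) i = (par ^^ n) (par i)" "(par ^^ Suc m) i = (par ^^ Suc n) (par i)"
        by (simp_all only: funpow_Suc_right o_apply)
      then show "late (par i)" using m unfolding late_def by metis
    next
      assume "late (par i)"
      then obtain m where m: "(par ^^ m) (par i) \<notin> D" "(par ^^ Suc m) (par i) \<in> D" "near (\<phi> ((par ^^ m) (par i)))"
        by (auto simp: late_def)
      have "(par ^^ m) (par i) = (par ^^ Suc m) i" "(par ^^ Suc m) (par i) = (par ^^ Suc (Suc m)) i"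
        by (simp_all only: funpow_Suc_right o_apply)
      then show "late i" using m unfolding late_def by metis
    qed
    then show ?thesis using False by simp
  qed
  \<comment> \<open>\<open>near\<close> fails at vertices off \<open>D\<close> and
    \<open>late\<close> fails on \<open>D\<close>, so at most one of the two holds. Components whose
    cycle is not in \<open>D\<close> contribute no corners.\<close>
  define Q where "Q = {d \<in> A. near d \<noteq> late (root d)}"
  have Q_iff: "d \<in> Q \<longleftrightarrow> near d \<noteq> late (root d)" if "d \<in> A" for d using that by (simp add: Q_def)
  have root_\<phi>: "root (\<phi> i) = par i" for i by (simp add: par_def)
  have edge: "\<tau> (\<phi> i) \<in> Q \<longleftrightarrow> i \<in> Q" "\<tau> i \<in> Q \<longleftrightarrow> \<phi> i \<in> Q" if i: "i \<in> I" for i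
  proof -
    have A: "i \<in> A" "\<phi> i \<in> A" "\<tau> i \<in> A" "\<tau> (\<phi> i) \<in> A" using i I_A \<phi>_in \<tau>_in by auto
    have r: "root i = i" "root (\<tau> i) = i" "root (\<tau> (\<phi> i)) = par i"
      using root_I i root_\<tau> A root_\<phi> by auto
    have "(near (\<tau> (\<phi> i)) \<noteq> late (par i)) = (near i \<noteq> late i) \<and> (near (\<tau> i) \<noteq> late i) = (near (\<phi> i) \<noteq> late (par i))"
    proof (cases "i \<in> D")
      case True
      then have "par i \<in> D" using DI by auto
      then show ?thesis using near_D[OF True] late_D True by auto
    next
      case False
      have "\<phi> i \<notin> D" using i I_S I_\<phi> DI by auto
      then have "near (\<tau> i) = near i" "near (\<tau> (\<phi> i)) = near (\<phi> i)"
        using near_I[of i] near_I[of "\<phi> i"] A False \<phi>_\<phi> by auto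
      moreover have "\<not> near i" using near_not[of i] False r by simp
      moreover have "late i \<longleftrightarrow> (if par i \<in> D then near (\<phi> i) else late (par i))" by (rule late_par[OF False])
      moreover have "par i \<notin> D \<Longrightarrow> \<not> near (\<phi> i)" using near_not[of "\<phi> i"] root_\<phi> by simp
      ultimately show ?thesis using late_D[of "par i"] by auto
    qed
    then show "\<tau> (\<phi> i) \<in> Q \<longleftrightarrow> i \<in> Q" "\<tau> i \<in> Q \<longleftrightarrow> \<phi> i \<in> Q"
      using A r root_\<phi> by (simp_all add: Q_iff)
  qed
  have "Q \<in> boundary_unions S"
  proof -
    have "(if d \<in> S then \<tau> (\<phi> d) else \<tau> d) \<in> Q \<longleftrightarrow> d \<in> Q" if d: "d \<in> A" for d
    proof (cases "d \<in> S")
      case True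
      show ?thesis
      proof (cases "d \<in> I")
        case False
        then have "\<phi> d \<in> I" using True I_\<phi> by auto
        from edge(2)[OF this] show ?thesis using True \<phi>_\<phi>[OF d] by simp
      qed (use True edge in simp)
    next
      case False
      then have "d \<notin> D" "\<phi> d \<notin> D" using DI I_S \<phi>_S \<phi>_\<phi>[OF d] by (metis subsetD)+
      then show ?thesis using near_I[OF d] False d \<tau>_in root_\<tau> by (simp add: Q_iff)
    qed
    then show ?thesis by (auto simp: boundary_unions_def Q_def)
  qed
  moreover have "changes Q \<inter> I = D"
  proof (rule set_eqI)
    fix i
    show "i \<in> changes Q \<inter> I \<longleftrightarrow> i \<in> D"
    proof (cases "i \<in> I")
      case True
      then have A: "i \<in> A" "\<tau> i \<in> A" using I_A \<tau>_in by auto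
      have "\<phi> i \<notin> D" using True I_S I_\<phi> DI by auto
      then show ?thesis using near_D[of i] near_I[of i] True A root_\<tau>
        by (auto simp: changes_def Q_iff)
    qed (use DI in auto)
  qed
  ultimately show ?thesis by blast
qed

end

section \<open>Counting unions of boundary curves and assignments of a functional graph\<close>

context rooted_ribbon begin

definition lift :: "'a set \<Rightarrow> 'a set" where "lift R = {d \<in> A. root d \<in> R}"

lemma lift_boundary:
  assumes "R \<in> invariant_sets par I"
  shows "lift R \<in> boundary_unions S"
proof -
  have "root (\<phi> d) \<in> R \<longleftrightarrow> root d \<in> R" if d: "d \<in> S" for d
  proof (cases "d \<in> I")
    case True
    then show ?thesis using assms root_I by (auto simp: invariant_sets_def par_def)
  next
    case False
    then have "\<phi> d \<in> I" "\<phi> (\<phi> d) = d" using I_\<phi> d S_in \<phi>_\<phi> by auto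
    then show ?thesis using assms root_I by (auto simp: invariant_sets_def par_def)
  qed
  then show ?thesis using root_\<tau> \<phi>_in \<tau>_in by (auto simp: boundary_unions_def lift_def)
qed

lemma lift_changes: "changes (lift R) = {}"
  using root_\<tau> \<tau>_in by (auto simp: changes_def lift_def)

text \<open>Without changes \<open>Q\<close> is a union of vertices, and the boundary rule then
  carries membership along the edges of \<open>S\<close>, that is, along \<open>par\<close>.\<close>

lemma boundary_without_changes:
  assumes Q: "Q \<in> boundary_unions S" and no: "changes Q \<inter> I = {}"
  shows "Q = lift (Q \<inter> I)" "Q \<inter> I \<in> invariant_sets par I"
proof -
  have "d \<notin> changes Q" if "d \<in> S" for d
    using changes_\<phi>[OF Q that] no I_\<phi>[OF that] by blast
  then have "changes Q = {}" using changes_S[OF Q] by auto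
  then have step: "\<tau> d \<in> Q \<longleftrightarrow> d \<in> Q" if "d \<in> A" for d using that by (auto simp: changes_def)
  have orb: "e \<in> Q \<longleftrightarrow> d \<in> Q" if "d \<in> A" "e \<in> orbit \<tau> d" for d e
    using that(2)
  proof induct
    case (step y)
    then have "y \<in> A" using orbit_in that(1) by auto
    then show ?case using step \<open>\<And>d. d \<in> A \<Longrightarrow> _ d\<close> by simp
  qed (use step that in auto)
  then have root: "root d \<in> Q \<longleftrightarrow> d \<in> Q" if "d \<in> A" for d using root_orbit that by blast
  show "Q = lift (Q \<inter> I)"
    using Q root root_in by (auto simp: lift_def boundary_unions_def)
  have "par i \<in> Q \<longleftrightarrow> i \<in> Q" if i: "i \<in> I" for i
  proof -
    have A: "i \<in> A" "\<phi> i \<in> A" "i \<in> S" using i I_A \<phi>_in I_S by auto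
    then have "\<tau> (\<phi> i) \<in> Q \<longleftrightarrow> i \<in> Q" using Q by (auto simp: boundary_unions_def)
    then show ?thesis using step[OF A(2)] root[OF A(2)] by (simp add: par_def)
  qed
  then show "Q \<inter> I \<in> invariant_sets par I" using par_in by (auto simp: invariant_sets_def)
qed

lemma boundary_symdiff:
  assumes "P \<in> boundary_unions S" "Q \<in> boundary_unions S"
  shows "(P - Q) \<union> (Q - P) \<in> boundary_unions S"
  using assms unfolding boundary_unions_def by blast

lemma changes_symdiff:
  "changes ((P - Q) \<union> (Q - P)) = (changes P - changes Q) \<union> (changes Q - changes P)"
  unfolding changes_def by blast

text \<open>A rank count over the field with two elements, symmetric difference being addition:
  \<open>Q\<close> is sent linearly to \<open>changes Q \<inter> I\<close>, the image is all of
  \<open>stable_sets par I\<close> by \<open>ex_side\<close>, and the kernel consists of the sets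
  \<open>lift R\<close>. Kernel and image are equally large since components and cycles
  correspond.\<close>

lemma card_boundary_unions: "card (boundary_unions S) = (card (stable_sets par I))\<^sup>2"
proof -
  \<comment> \<open>An arbitrary section of this map; adding \<open>lift R\<close> then gives the
    whole fibre over \<open>D\<close>.\<close>
  define side where "side D = (SOME Q. Q \<in> boundary_unions S \<and> changes Q \<inter> I = D)" for D
  have side: "side D \<in> boundary_unions S" "changes (side D) \<inter> I = D" if "D \<in> stable_sets par I" for D
    using someI_ex[OF ex_side[OF that, unfolded Bex_def]] by (auto simp: side_def)
  let ?f = "\<lambda>(D, R). (side D - lift R) \<union> (lift R - side D)"
  have ch: "changes ((side D - lift R) \<union> (lift R - side D)) \<inter> I = D" if "D \<in> stable_sets par I" for D R
    unfolding changes_symdiff lift_changes using side(2)[OF that] by auto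
  have inj_lift: "R \<inter> I = lift R \<inter> I" for R using root_I I_A by (auto simp: lift_def)
  have "bij_betw ?f (stable_sets par I \<times> invariant_sets par I) (boundary_unions S)"
  proof (intro bij_betw_imageI inj_onI)
    fix x y assume x: "x \<in> stable_sets par I \<times> invariant_sets par I"
      and y: "y \<in> stable_sets par I \<times> invariant_sets par I" and eq: "?f x = ?f y"
    obtain D R D' R' where xy: "x = (D, R)" "y = (D', R')" by (metis surj_pair)
    have D: "D = D'" using ch[of D R] ch[of D' R'] x y eq unfolding xy by simp
    have "lift R = lift R'" using eq unfolding xy D by auto
    then have "R \<inter> I = R' \<inter> I" using inj_lift[of R] inj_lift[of R'] by simp
    then have "R = R'" using x y unfolding xy invariant_sets_def by auto
    then show "x = y" using D xy by simp
  next
    show "?f ` (stable_sets par I \<times> invariant_sets par I) = boundary_unions S"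
    proof (intro set_eqI iffI)
      fix Q assume "Q \<in> ?f ` (stable_sets par I \<times> invariant_sets par I)"
      then show "Q \<in> boundary_unions S" using boundary_symdiff[OF side(1) lift_boundary] by auto
    next
      fix Q assume Q: "Q \<in> boundary_unions S"
      let ?D = "changes Q \<inter> I"
      have D: "?D \<in> stable_sets par I" by (rule changes_stable[OF Q])
      let ?P = "(Q - side ?D) \<union> (side ?D - Q)"
      have P: "?P \<in> boundary_unions S" by (rule boundary_symdiff[OF Q side(1)[OF D]])
      have no: "changes ?P \<inter> I = {}" unfolding changes_symdiff using side(2)[OF D] by auto
      have "Q = (side ?D - ?P) \<union> (?P - side ?D)" by auto
      also have "\<dots> = ?f (?D, ?P \<inter> I)"
        using boundary_without_changes(1)[OF P no] by simp
      finally show "Q \<in> ?f ` (stable_sets par I \<times> invariant_sets par I)"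
        using D boundary_without_changes(2)[OF P no] by (rule image_eqI[OF _ SigmaI])
    qed
  qed
  then have "card (boundary_unions S) = card (stable_sets par I \<times> invariant_sets par I)"
    by (rule bij_betw_same_card[symmetric])
  then show ?thesis
    using card_invariant_sets[OF finite_I par_image] by (simp add: card_cartesian_product power2_eq_square)
qed

text \<open>An assignment \<open>J\<close> differs from \<open>I\<close> by reversing the edges in
  \<open>I - J\<close>. A vertex that gives up its edge needs another one, which must also have been
  reversed; so the reversed edges form cycles of \<open>par\<close>.\<close>

lemma card_transversals: "card (transversals S) = card (stable_sets par I)"
proof -
  have Jset: "J = (I - (I - J)) \<union> \<phi> ` (I - J)" if J: "J \<in> transversals S" for J
  proof -
    have JS: "J \<subseteq> S" and J\<phi>: "d \<in> S \<Longrightarrow> d \<in> J \<longleftrightarrow> \<phi> d \<notin> J" for d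
      using J by (auto simp: transversals_def)
    show ?thesis
    proof (intro set_eqI iffI)
      fix d assume d: "d \<in> J"
      then have dS: "d \<in> S" "\<phi> (\<phi> d) = d" using JS S_in \<phi>_\<phi> by auto
      show "d \<in> (I - (I - J)) \<union> \<phi> ` (I - J)"
      proof (cases "d \<in> I")
        case False
        then have "\<phi> d \<in> I - J" using I_\<phi> J\<phi> dS d by auto
        then show ?thesis using dS by (metis UnI2 imageI)
      qed (use d in auto)
    next
      fix d assume "d \<in> (I - (I - J)) \<union> \<phi> ` (I - J)"
      then show "d \<in> J" using J\<phi> I_S by auto
    qed
  qed
  have "bij_betw (\<lambda>J. I - J) (transversals S) (stable_sets par I)"
  proof (intro bij_betw_imageI inj_onI set_eqI iffI)
    fix J J' x assume "J \<in> transversals S" "J' \<in> transversals S" "I - J = I - J'"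
    then have "J = J'" using Jset by metis
    then show "x \<in> J \<Longrightarrow> x \<in> J'" "x \<in> J' \<Longrightarrow> x \<in> J" by auto
  next
    fix D assume "D \<in> (\<lambda>J. I - J) ` transversals S"
    then obtain J where J: "J \<in> transversals S" "D = I - J" by auto
    show "D \<in> stable_sets par I"
    proof (rule stable_setsI[OF finite_I])
      show "D \<subseteq> par ` D"
      proof
        fix i assume i: "i \<in> D"
        then have iA: "i \<in> A" "i \<in> I" using J I_A by auto
        obtain j where j: "j \<in> J" "j \<in> orbit \<tau> i" using J iA by (auto simp: transversals_def)
        have jS: "j \<in> S" "j \<in> A" using J j S_in by (auto simp: transversals_def)
        have "j \<notin> I"
        proof
          assume "j \<in> I"
          then have "j = i" using ex1_I[OF iA(1)] iA(2) self_orbit[OF iA(1)] j(2) by blast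
          then show False using i j(1) J(2) by simp
        qed
        then have "\<phi> j \<in> I" using I_\<phi> jS by auto
        moreover have "\<phi> j \<notin> J" using J j jS by (auto simp: transversals_def)
        moreover have "par (\<phi> j) = i"
          using root_cong[OF iA(1) j(2)] root_I[OF iA(2)] by (simp add: par_def \<phi>_\<phi>[OF jS(2)])
        ultimately show "i \<in> par ` D" using J(2) by (metis DiffI imageI)
      qed
    qed (use J in auto)
  next
    fix D assume D: "D \<in> stable_sets par I"
    then have DI: "D \<subseteq> I" "par ` D = D" by (auto simp: stable_sets_def)
    have inj: "inj_on par D" using stable_sets_bij_betw[OF finite_I D] by (auto simp: bij_betw_def)
    \<comment> \<open>The edges of the cycles in \<open>D\<close> pass to the owner at their other
      end.\<close>
    let ?J = "(I - D) \<union> \<phi> ` D"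
    have \<phi>D: "\<phi> d \<in> D \<Longrightarrow> d \<in> \<phi> ` D" if "d \<in> S" for d
      using that S_in \<phi>_\<phi> by (metis imageI subsetD)
    have \<phi>D': "d \<notin> I" "\<phi> d \<in> D" if "d \<in> \<phi> ` D" for d
      using that DI I_S I_\<phi> I_A \<phi>_\<phi> by auto
    have "?J \<subseteq> S" using I_S DI \<phi>_S by auto
    moreover have "d \<in> ?J \<longleftrightarrow> \<phi> d \<notin> ?J" if d: "d \<in> S" for d
    proof -
      have p: "\<phi> d \<in> S" "\<phi> (\<phi> d) = d" using d \<phi>_S S_in \<phi>_\<phi> by auto
      have "d \<in> \<phi> ` D \<longleftrightarrow> \<phi> d \<in> D" using \<phi>D[OF d] \<phi>D' by auto
      moreover have "\<phi> d \<in> \<phi> ` D \<longleftrightarrow> d \<in> D" using \<phi>D[OF p(1)] \<phi>D'[of "\<phi> d"] p by auto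
      ultimately show ?thesis using I_\<phi>[OF d] DI by auto
    qed
    moreover have "\<exists>!j. j \<in> ?J \<and> j \<in> orbit \<tau> d" if d: "d \<in> A" for d
    proof (cases "root d \<in> D")
      case True
      then obtain j where j: "j \<in> D" "root d = par j" using DI by auto
      have jA: "\<phi> j \<in> A" using j DI I_A \<phi>_in by auto
      have "orbit \<tau> (\<phi> j) = orbit \<tau> d"
        using orbit_eq[OF jA root_orbit[OF jA]] orbit_eq[OF d root_orbit[OF d]] j by (simp add: par_def)
      then have "\<phi> j \<in> orbit \<tau> d" using self_orbit[OF jA] by simp
      moreover have "y = \<phi> j" if y: "y \<in> ?J" "y \<in> orbit \<tau> d" for y
      proof -
        have ry: "root y = root d" using root_cong[OF d y(2)] .
        have "y \<notin> I - D" using ry root_I True by auto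
        then obtain l where l: "l \<in> D" "y = \<phi> l" using y by auto
        then have "par l = par j" using ry j by (simp add: par_def)
        then show ?thesis using inj l j by (auto dest: inj_onD)
      qed
      ultimately show ?thesis using j by (intro ex1I[of _ "\<phi> j"]) auto
    next
      case False
      have "y = root d" if y: "y \<in> ?J" "y \<in> orbit \<tau> d" for y
      proof -
        have ry: "root y = root d" using root_cong[OF d y(2)] .
        have "y \<notin> \<phi> ` D"
        proof
          assume "y \<in> \<phi> ` D"
          then have "root y \<in> par ` D" by (auto simp: par_def)
          then show False using ry False DI(2) by simp
        qed
        then show ?thesis using y ry root_I by auto
      qed
      then show ?thesis using root_in[OF d] root_orbit[OF d] False by (intro ex1I[of _ "root d"]) auto
    qed
    ultimately have "?J \<in> transversals S" by (simp add: transversals_def)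
    moreover have "I - ?J = D" using DI \<phi>D' by auto
    ultimately show "D \<in> (\<lambda>J. I - J) ` transversals S" by (metis imageI)
  qed
  then show ?thesis by (rule bij_betw_same_card)
qed

end

text \<open>Rooted at \<open>J\<close>, the dual graph has the same unions of boundary curves. Each
  graph's number of unions of cycles is the square root of their count.\<close>

lemma (in rooted_ribbon) card_dual_transversals_stable:
  assumes J: "J \<in> ribbon_map.transversals A (\<tau> \<circ> \<phi>) \<phi> (A - S)"
  shows "card (ribbon_map.transversals A (\<tau> \<circ> \<phi>) \<phi> (A - S)) = card (stable_sets par I)"
proof -
  interpret dual: ribbon_map A "\<tau> \<circ> \<phi>" \<phi> by (rule dual)
  interpret dual: rooted_ribbon A "\<tau> \<circ> \<phi>" \<phi> "A - S" J
  proof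
    fix d assume "d \<in> A - S"
    then show "\<phi> d \<in> A - S" using \<phi>_in \<phi>_S \<phi>_\<phi> by (metis Diff_iff)
  qed (use J in auto)
  have "(card (stable_sets dual.par J))\<^sup>2 = (card (stable_sets par I))\<^sup>2"
    using dual.card_boundary_unions card_boundary_unions boundary_unions_dual by simp
  then show ?thesis using dual.card_transversals by (simp add: power2_eq_iff_nonneg)
qed

section \<open>Existence of a transversal\<close>

text \<open>The component of the half-edge \<open>x\<close> in the graph with rotation
  \<open>f\<close> and edge set \<open>E\<close>. For a permutation of a finite set, backward turns
  are iterated forward turns.\<close>

inductive_set reach :: "('a \<Rightarrow> 'a) \<Rightarrow> ('a \<Rightarrow> 'a) \<Rightarrow> 'a set \<Rightarrow> 'a \<Rightarrow> 'a set" for f \<phi> E x where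
  reach_refl: "x \<in> reach f \<phi> E x"
| reach_f: "y \<in> reach f \<phi> E x \<Longrightarrow> f y \<in> reach f \<phi> E x"
| reach_\<phi>: "y \<in> reach f \<phi> E x \<Longrightarrow> y \<in> E \<Longrightarrow> \<phi> y \<in> reach f \<phi> E x"

lemma reach_minimal:
  assumes "x \<in> P" "\<And>y. y \<in> P \<Longrightarrow> f y \<in> P" "\<And>y. y \<in> P \<Longrightarrow> y \<in> E \<Longrightarrow> \<phi> y \<in> P"
  shows "reach f \<phi> E x \<subseteq> P"
proof
  fix y assume "y \<in> reach f \<phi> E x" then show "y \<in> P" by induct (auto simp: assms)
qed

context ribbon_map begin

lemma reach_in: "d \<in> A \<Longrightarrow> reach \<tau> \<phi> E d \<subseteq> A"
  by (rule reach_minimal) (auto simp: \<tau>_in \<phi>_in)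

lemma reach_\<tau>_iff: "d \<in> A \<Longrightarrow> x \<in> A \<Longrightarrow> \<tau> x \<in> reach \<tau> \<phi> E d \<longleftrightarrow> x \<in> reach \<tau> \<phi> E d"
  by (rule bij_betw_closed_iff[OF finite_A bij_\<tau> reach_in]) (auto intro: reach_f)

lemma reach_\<phi>_iff:
  assumes "\<And>d. d \<in> E \<Longrightarrow> \<phi> d \<in> E" "x \<in> A" "x \<in> E"
  shows "\<phi> x \<in> reach \<tau> \<phi> E d \<longleftrightarrow> x \<in> reach \<tau> \<phi> E d"
  using assms reach_\<phi>[of x \<tau> \<phi> E d] reach_\<phi>[of "\<phi> x" \<tau> \<phi> E d] \<phi>_\<phi>[of x] by auto

lemma reach_sym:
  assumes E: "\<And>d. d \<in> E \<Longrightarrow> \<phi> d \<in> E" and d: "d \<in> A" "e \<in> reach \<tau> \<phi> E d"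
  shows "d \<in> reach \<tau> \<phi> E e"
proof (rule ccontr)
  assume n: "d \<notin> reach \<tau> \<phi> E e"
  have "e \<in> A" using d reach_in by auto
  then have "reach \<tau> \<phi> E d \<subseteq> A - reach \<tau> \<phi> E e"
    using d n reach_\<tau>_iff reach_\<phi>_iff[OF E] \<tau>_in \<phi>_in by (intro reach_minimal) auto
  then show False using d reach_refl by fast
qed

lemma reach_eq:
  assumes E: "\<And>d. d \<in> E \<Longrightarrow> \<phi> d \<in> E" and d: "d \<in> A" "e \<in> reach \<tau> \<phi> E d"
  shows "reach \<tau> \<phi> E e = reach \<tau> \<phi> E d"
proof
  show "reach \<tau> \<phi> E e \<subseteq> reach \<tau> \<phi> E d" using d by (intro reach_minimal) (auto intro: reach_f reach_\<phi>)
  show "reach \<tau> \<phi> E d \<subseteq> reach \<tau> \<phi> E e"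
    using reach_sym[OF E d] by (intro reach_minimal) (auto intro: reach_f reach_\<phi>)
qed

text \<open>An even subgraph contains no bridge. If \<open>d\<close> were one, take the piece
  \<open>?P\<close> that remains at \<open>d\<close> when its edge is deleted: the number of changes
  in \<open>?P\<close> is even, yet all of them except \<open>d\<close> are paired by
  \<open>\<phi>\<close>.\<close>

lemma no_changes_on_bridges:
  assumes K: "K \<subseteq> A" "\<And>d. d \<in> K \<Longrightarrow> \<tau> d \<in> K" "\<And>d. d \<in> K \<Longrightarrow> d \<in> H \<Longrightarrow> \<phi> d \<in> K"
    and bridges: "\<And>d. d \<in> K \<Longrightarrow> d \<in> H \<Longrightarrow> \<phi> d \<notin> reach \<tau> \<phi> (H - {d, \<phi> d}) d"
    and Q: "changes Q \<inter> K \<subseteq> H" "\<And>d. d \<in> changes Q \<inter> K \<Longrightarrow> \<phi> d \<in> changes Q"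
  shows "changes Q \<inter> K = {}"
proof (rule ccontr)
  let ?z = "changes Q \<inter> K"
  assume "?z \<noteq> {}"
  then obtain d where d: "d \<in> ?z" by auto
  then have dH: "d \<in> K" "d \<in> H" "d \<in> A" using Q K by auto
  let ?P = "reach \<tau> \<phi> (H - {d, \<phi> d}) d"
  have P: "?P \<subseteq> K" using dH K by (intro reach_minimal) auto
  have PA: "?P \<subseteq> A" using P K by auto
  have "even (card {x \<in> ?P. (x \<in> Q) \<noteq> (\<tau> x \<in> Q)})"
    using finite_subset[OF PA finite_A] bij_betw_closed_subset[OF finite_A bij_\<tau> PA reach_f]
    by (rule even_card_changes)
  also have "{x \<in> ?P. (x \<in> Q) \<noteq> (\<tau> x \<in> Q)} = insert d (?z \<inter> ?P - {d})"
    using d P K reach_refl[of d] by (auto simp: changes_def)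
  finally have "even (Suc (card (?z \<inter> ?P - {d})))"
    using finite_subset[OF PA finite_A] by (subst (asm) card_insert_disjoint) auto
  moreover have "even (card (?z \<inter> ?P - {d}))"
  proof (rule even_card_involution[of _ \<phi>])
    fix x assume x: "x \<in> ?z \<inter> ?P - {d}"
    then have xA: "x \<in> A" "x \<in> H" using Q K by auto
    show "\<phi> (\<phi> x) = x" "\<phi> x \<noteq> x" using \<phi>_\<phi> \<phi>_neq xA by auto
    have "x \<noteq> \<phi> d" using x bridges[OF dH(1,2)] by auto
    then have "\<phi> x \<noteq> d" "x \<in> H - {d, \<phi> d}" using xA x \<phi>_\<phi>[of x] by auto
    moreover from this have "\<phi> x \<in> ?P" using x reach_\<phi> by fast
    ultimately show "\<phi> x \<in> ?z \<inter> ?P - {d}" using Q(2) x K(3) xA by auto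
  qed (use finite_subset[OF PA finite_A] in auto)
  ultimately show False by simp
qed

end

text \<open>Otherwise the dual component \<open>K\<close> of \<open>d0\<close> is a tree, and no
  union of boundary curves distinguishes its corners. Applied to the components of \<open>S\<close>,
  this shows that \<open>K\<close> borders at most one cycle, whence \<open>nonsep\<close> gives
  \<open>K = A\<close>; but then either \<open>K\<close> has no border at all, or one side of a
  cycle does distinguish corners of \<open>K\<close>.\<close>

lemma (in rooted_ribbon) ex_nonbridge:
  assumes nonsep: "\<And>C K. C \<in> cyclic_orbits par I \<Longrightarrow> K \<subseteq> A \<Longrightarrow> K \<noteq> {} \<Longrightarrow>
      (\<And>d. d \<in> K \<Longrightarrow> \<tau> (\<phi> d) \<in> K) \<Longrightarrow>
      (\<And>d. d \<in> K \<Longrightarrow> d \<notin> C \<Longrightarrow> \<phi> d \<notin> C \<Longrightarrow> \<phi> d \<in> K) \<Longrightarrow> K = A"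
    and d0: "d0 \<in> A"
  shows "\<exists>e \<in> reach (\<tau> \<circ> \<phi>) \<phi> (A - S) d0 \<inter> (A - S). \<phi> e \<in> reach (\<tau> \<circ> \<phi>) \<phi> (A - S - {e, \<phi> e}) e"
proof (rule ccontr)
  assume contra: "\<not> ?thesis"
  interpret dual: ribbon_map A "\<tau> \<circ> \<phi>" \<phi> by (rule dual)
  define K where "K = reach (\<tau> \<circ> \<phi>) \<phi> (A - S) d0"
  have H\<phi>: "\<phi> d \<in> A - S" if "d \<in> A - S" for d
    using that \<phi>_in \<phi>_S \<phi>_\<phi> by (metis Diff_iff)
  have KA: "K \<subseteq> A" and d0K: "d0 \<in> K" using dual.reach_in[OF d0] reach_refl by (auto simp: K_def)
  have K\<sigma>: "\<tau> (\<phi> d) \<in> K \<longleftrightarrow> d \<in> K" if "d \<in> A" for d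
    using dual.reach_\<tau>_iff[OF d0 that] by (simp add: K_def)
  have K\<phi>: "\<phi> d \<in> K \<longleftrightarrow> d \<in> K" if "d \<in> A - S" for d
    using dual.reach_\<phi>_iff[OF H\<phi>, of d d0] that by (simp add: K_def)
  \<comment> \<open>A region whose graph is a tree has a single boundary curve.\<close>
  have const: "d \<in> Q \<longleftrightarrow> d0 \<in> Q" if Q: "Q \<in> boundary_unions S" and "d \<in> K" for Q d
  proof -
    have Qd: "(if d \<in> S then \<tau> (\<phi> d) else \<tau> d) \<in> Q \<longleftrightarrow> d \<in> Q" if "d \<in> A" for d
      using Q that by (simp add: boundary_unions_def)
    have ch: "d \<in> dual.changes Q \<longleftrightarrow> d \<in> A - S \<and> (d \<in> Q) \<noteq> (\<phi> d \<in> Q)" for d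
    proof (cases "d \<in> A")
      case True
      show ?thesis
      proof (cases "d \<in> S")
        case True
        then show ?thesis using Qd[OF \<open>d \<in> A\<close>] by (simp add: dual.changes_def)
      next
        case False
        have "\<phi> d \<in> A - S" using H\<phi> False \<open>d \<in> A\<close> by auto
        then show ?thesis using Qd[of "\<phi> d"] False \<open>d \<in> A\<close> by (auto simp: dual.changes_def)
      qed
    qed (simp add: dual.changes_def)
    have none: "dual.changes Q \<inter> K = {}"
    proof (rule dual.no_changes_on_bridges[where H = "A - S"])
      show "K \<subseteq> A" by (rule KA)
      show "(\<tau> \<circ> \<phi>) d \<in> K" if "d \<in> K" for d using K\<sigma>[of d] that KA by auto
      show "\<phi> d \<in> K" if "d \<in> K" "d \<in> A - S" for d using K\<phi>[of d] that by auto
      show "\<phi> d \<notin> reach (\<tau> \<circ> \<phi>) \<phi> (A - S - {d, \<phi> d}) d" if "d \<in> K" "d \<in> A - S" for d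
        using contra that by (auto simp: K_def)
      show "dual.changes Q \<inter> K \<subseteq> A - S" using ch by auto
      show "\<phi> d \<in> dual.changes Q" if "d \<in> dual.changes Q \<inter> K" for d
        using ch[of d] ch[of "\<phi> d"] that H\<phi>[of d] \<phi>_\<phi>[of d] by auto
    qed
    have "K \<subseteq> {d \<in> K. d \<in> Q \<longleftrightarrow> d0 \<in> Q}"
      unfolding K_def
    proof (rule reach_minimal, unfold K_def[symmetric])
      show "d0 \<in> {d \<in> K. d \<in> Q \<longleftrightarrow> d0 \<in> Q}" using d0K by simp
    next
      fix y assume y: "y \<in> {d \<in> K. d \<in> Q \<longleftrightarrow> d0 \<in> Q}"
      then have "y \<notin> dual.changes Q" "y \<in> A" using none KA by auto
      then have "\<tau> (\<phi> y) \<in> Q \<longleftrightarrow> y \<in> Q" by (auto simp: dual.changes_def)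
      then show "(\<tau> \<circ> \<phi>) y \<in> {d \<in> K. d \<in> Q \<longleftrightarrow> d0 \<in> Q}" using y K\<sigma>[OF \<open>y \<in> A\<close>] by simp
    next
      fix y assume y: "y \<in> {d \<in> K. d \<in> Q \<longleftrightarrow> d0 \<in> Q}" and yH: "y \<in> A - S"
      then have "\<not> (y \<in> Q) \<noteq> (\<phi> y \<in> Q)" using none ch[of y] by auto
      then show "\<phi> y \<in> {d \<in> K. d \<in> Q \<longleftrightarrow> d0 \<in> Q}" using y K\<phi>[OF yH] by simp
    qed
    then show ?thesis using that by auto
  qed
  have K\<tau>: "\<tau> d \<in> K \<longleftrightarrow> \<phi> d \<in> K" if "d \<in> A" for d
    using K\<sigma>[of "\<phi> d"] \<phi>_in[OF that] \<phi>_\<phi>[OF that] by simp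
  \<comment> \<open>\<open>K\<close> is a union of dual vertices, so the corners on either side of
    \<open>d\<close> belong to the two ends of the dual edge of \<open>d\<close>.\<close>
  have ch: "d \<in> changes K \<longleftrightarrow> d \<in> A \<and> (d \<in> K) \<noteq> (\<phi> d \<in> K)" for d
    using K\<tau> by (auto simp: changes_def)
  have chS: "changes K \<subseteq> S" using ch K\<phi> by auto
  have ch\<phi>: "\<phi> d \<in> changes K" if "d \<in> changes K" for d
    using that ch[of d] ch[of "\<phi> d"] \<phi>_in \<phi>_\<phi> by auto
  let ?D = "changes K \<inter> I"
  have D: "?D \<in> stable_sets par I"
    by (rule stable_if_even[OF chS ch\<phi>]) (use even_changes_orbit I_A in auto)
  show False
  proof (cases "?D = {}")
    case True
    \<comment> \<open>No edge leaves \<open>K\<close> in this case, so \<open>nonsep\<close> for any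
      cycle of \<open>S\<close> makes \<open>K\<close> everything, and one side of that cycle
      contradicts \<open>const\<close>.\<close>
    have \<phi>K: "\<phi> d \<in> K" if "d \<in> K" for d
    proof (rule ccontr)
      assume "\<phi> d \<notin> K"
      then have "d \<in> changes K" using that ch KA by auto
      then have "d \<in> ?D \<or> \<phi> d \<in> ?D" using chS ch\<phi> I_\<phi>[of d] by auto
      then show False using True by auto
    qed
    obtain n where n: "(par ^^ n) (root d0) \<in> orbit par ((par ^^ n) (root d0))" (is "?x \<in> _")
      using eventually_cyclic[OF finite_I par_image root_in[OF d0]] by blast
    have xI: "?x \<in> I" by (rule funpow_closed[OF par_image root_in[OF d0]])
    let ?C = "orbit par ?x"
    have C: "?C \<in> cyclic_orbits par I" using n xI by (auto simp: cyclic_orbits_def)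
    have KA': "K = A" by (rule nonsep[OF C KA]) (use d0K K\<sigma> KA \<phi>K in auto)
    have "?C \<in> stable_sets par I"
      using cyclic_orbit_stable[OF par_image xI n] by (simp add: stable_sets_def)
    then obtain Q where Q: "Q \<in> boundary_unions S" "changes Q \<inter> I = ?C" using ex_side by blast
    have "?x \<in> changes Q" using Q n by auto
    then show False using const[OF Q(1)] KA' \<tau>_in by (auto simp: changes_def)
  next
    case False
    then obtain x where x: "x \<in> ?D" by auto
    then have xI: "x \<in> I" "x \<in> A" using I_A by auto
    let ?C = "orbit par x"
    have xC: "x \<in> ?C" by (rule stable_sets_cyclic(1)[OF finite_I D x])
    have C: "?C \<in> cyclic_orbits par I" using xC xI by (auto simp: cyclic_orbits_def)
    have Cst: "?C \<in> stable_sets par I"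
      using cyclic_orbit_stable[OF par_image xI(1) xC] by (simp add: stable_sets_def)
    \<comment> \<open>The component of the cycle \<open>?C\<close>. As \<open>lift R\<close> is
      constant on \<open>K\<close>, all edges on the border of \<open>K\<close> belong to this
      component, and since they lie on cycles, to \<open>?C\<close>.\<close>
    define R where "R = {i \<in> I. \<exists>n. (par ^^ n) i \<in> ?C}"
    have R: "R \<in> invariant_sets par I"
      unfolding R_def by (rule stable_preimage_invariant[OF par_image Cst])
    have near: "\<exists>d \<in> K. d \<in> A \<and> (root d \<in> R \<longleftrightarrow> y \<in> R)" if y: "y \<in> ?D" for y
    proof -
      have yI: "y \<in> I" using y by auto
      have "root y = y" "root (\<phi> y) = par y" using root_I[OF yI] by (auto simp: par_def)
      moreover have "par y \<in> R \<longleftrightarrow> y \<in> R" using R yI by (auto simp: invariant_sets_def)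
      moreover have "y \<in> K \<or> \<phi> y \<in> K" using y ch by auto
      ultimately show ?thesis using KA by (metis subsetD)
    qed
    have inR: "root d \<in> R \<longleftrightarrow> d0 \<in> lift R" if "d \<in> K" for d
      using const[OF lift_boundary[OF R] that] that KA by (auto simp: lift_def)
    have "x \<in> R" using xI xC by (auto simp: R_def intro: exI[of _ 0])
    then have "d0 \<in> lift R" using near[OF x] inR by blast
    then have DR: "y \<in> R" if "y \<in> ?D" for y using near[OF that] inR by blast
    have DC: "?D \<subseteq> ?C"
    proof
      fix y assume y: "y \<in> ?D"
      then obtain n where "(par ^^ n) y \<in> ?C" using DR by (auto simp: R_def)
      then show "y \<in> ?C"
        using stable_if_cyclic_preimage[OF finite_I Cst] stable_sets_cyclic(1)[OF finite_I D y] by blast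
    qed
    have "K = A"
    proof (rule nonsep[OF C KA])
      show "K \<noteq> {}" using d0K by auto
      show "\<tau> (\<phi> d) \<in> K" if "d \<in> K" for d using that K\<sigma> KA by auto
      show "\<phi> d \<in> K" if d: "d \<in> K" "d \<notin> ?C" "\<phi> d \<notin> ?C" for d
      proof (rule ccontr)
        assume "\<phi> d \<notin> K"
        then have "d \<in> changes K" using d ch KA by auto
        then have "d \<in> ?D \<or> \<phi> d \<in> ?D" using chS ch\<phi> I_\<phi>[of d] by auto
        then show False using d DC by blast
      qed
    qed
    then show False using x ch[of x] \<phi>_in by auto
  qed
qed

context ribbon_map begin

text \<open>Let the vertex of \<open>e\<close> own \<open>e\<close>, and grow a spanning tree that
  avoids this edge, each new vertex owning the edge by which it is reached. The tree fills the
  component because \<open>e\<close> is not a bridge.\<close>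

lemma class_transversal:
  assumes H: "H \<subseteq> A" "\<And>d. d \<in> H \<Longrightarrow> \<phi> d \<in> H" and d0: "d0 \<in> A"
    and e: "e \<in> reach \<tau> \<phi> H d0" "e \<in> H" "\<phi> e \<in> reach \<tau> \<phi> (H - {e, \<phi> e}) e"
  shows "\<exists>J. J \<subseteq> reach \<tau> \<phi> H d0 \<inter> H \<and> (\<forall>j\<in>J. \<phi> j \<notin> J) \<and>
    (\<forall>d\<in>reach \<tau> \<phi> H d0. \<exists>!j. j \<in> J \<and> j \<in> orbit \<tau> d)"
proof -
  let ?K = "reach \<tau> \<phi> H d0" and ?K' = "reach \<tau> \<phi> (H - {e, \<phi> e}) e"
  have eA: "e \<in> A" using e H by auto
  have KA: "?K \<subseteq> A" by (rule reach_in[OF d0])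
  have Ke: "?K = reach \<tau> \<phi> H e" using reach_eq[OF H(2) d0 e(1)] by simp
  have K': "?K \<subseteq> ?K'"
    unfolding Ke
  proof (rule reach_minimal)
    show "\<phi> y \<in> ?K'" if "y \<in> ?K'" "y \<in> H" for y
      using that e(3) \<phi>_\<phi>[OF eA] by (cases "y = e \<or> y = \<phi> e") (auto intro: reach_\<phi> reach_refl)
  qed (auto intro: reach_refl reach_f)
  \<comment> \<open>Stages of the growth, \<open>U\<close> being the union of the vertices reached.
    Owned edges other than \<open>e\<close> have both ends in \<open>U\<close>, so an edge leaving
    \<open>U\<close> is still free.\<close>
  define good where "good = (\<lambda>(U, J). U \<subseteq> ?K \<and> (\<forall>d\<in>U. \<tau> d \<in> U) \<and> e \<in> U \<and> J \<subseteq> U \<inter> H \<and>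
    (\<forall>j\<in>J. \<phi> j \<notin> J) \<and> (\<forall>j\<in>J. j \<noteq> e \<longrightarrow> \<phi> j \<in> U) \<and> (\<forall>d\<in>U. \<exists>!j. j \<in> J \<and> j \<in> orbit \<tau> d))"
  have orb_uniq: "\<exists>!j. j \<in> J \<and> j \<in> orbit \<tau> d"
    if "a \<in> A" "a \<in> J" "J \<inter> orbit \<tau> a = {a}" "d \<in> orbit \<tau> a" for a d J
    unfolding orbit_eq[OF that(1,4)] using that(2,3) self_orbit[OF that(1)] by (metis IntI singletonD)
  have "good (orbit \<tau> e, {e})"
  proof -
    have "orbit \<tau> e \<subseteq> ?K" unfolding Ke by (rule orbit_subset_closed) (auto intro: reach_refl reach_f)
    then show ?thesis using e(2) \<phi>_neq[OF eA] self_orbit[OF eA] orb_uniq[OF eA]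
      unfolding good_def by (auto intro: orbit.step)
  qed
  moreover have "\<forall>p. good p \<longrightarrow> card (fst p) \<le> card ?K"
    using finite_subset[OF KA finite_A] by (auto simp: good_def intro: card_mono)
  ultimately obtain p where p: "good p" "\<And>q. good q \<Longrightarrow> card (fst q) \<le> card (fst p)"
    using ex_has_greatest_nat[of good "(orbit \<tau> e, {e})" "\<lambda>p. card (fst p)"] le_imp_less_Suc by blast
  obtain U J where UJ: "p = (U, J)" by (metis surj_pair)
  have U: "U \<subseteq> ?K" "\<And>d. d \<in> U \<Longrightarrow> \<tau> d \<in> U" "e \<in> U" and J: "J \<subseteq> U" "J \<subseteq> H" "\<And>j. j \<in> J \<Longrightarrow> \<phi> j \<notin> J"
    "\<And>j. j \<in> J \<Longrightarrow> j \<noteq> e \<Longrightarrow> \<phi> j \<in> U" "\<And>d. d \<in> U \<Longrightarrow> \<exists>!j. j \<in> J \<and> j \<in> orbit \<tau> d"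
    using p(1) by (auto simp: good_def UJ)
  have UA: "U \<subseteq> A" using U KA by auto
  \<comment> \<open>For the largest stage: an edge leaving \<open>U\<close> would let its outer
    vertex be added as the owner of that edge.\<close>
  have "?K' \<subseteq> U"
  proof (rule reach_minimal[OF U(3) U(2)])
    fix y assume y: "y \<in> U" "y \<in> H - {e, \<phi> e}"
    show "\<phi> y \<in> U"
    proof (rule ccontr)
      assume n: "\<phi> y \<notin> U"
      let ?a = "\<phi> y"
      have a: "?a \<in> A" "?a \<in> H" "?a \<in> ?K" "\<phi> ?a = y"
        using y UA \<phi>_in H \<phi>_\<phi> U by (auto intro: reach_\<phi>)
      let ?O = "orbit \<tau> ?a"
      have OU: "?O \<inter> U = {}"
      proof (rule ccontr)
        assume "?O \<inter> U \<noteq> {}"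
        then obtain b where "b \<in> ?O" "b \<in> U" by auto
        then have "?a \<in> orbit \<tau> b" using orbit_swap self_orbit a(1) by fast
        then have "?a \<in> U" using orbit_subset_closed[of U \<tau>, OF U(2) \<open>b \<in> U\<close>] by auto
        then show False using n by simp
      qed
      have aO: "?a \<in> ?O" by (rule self_orbit[OF a(1)])
      have "good (U \<union> ?O, insert ?a J)"
        unfolding good_def prod.case
      proof (intro conjI ballI impI)
        show "U \<union> ?O \<subseteq> ?K" using U a orbit_subset_closed[of ?K \<tau> ?a] by (auto intro: reach_f)
        show "\<tau> d \<in> U \<union> ?O" if "d \<in> U \<union> ?O" for d using that U by (auto intro: orbit.step)
        show "e \<in> U \<union> ?O" using U by auto
        show "insert ?a J \<subseteq> (U \<union> ?O) \<inter> H" using J a aO by auto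
        show "\<phi> j \<notin> insert ?a J" if "j \<in> insert ?a J" for j
        proof (cases "j = ?a")
          case True
          have "y \<notin> J" using J(4)[of y] n y by auto
          moreover have "y \<noteq> ?a" using y n by auto
          ultimately show ?thesis using True a(4) by simp
        next
          case False
          then have j: "j \<in> J" "\<phi> j \<notin> J" using that J(3) by auto
          have "\<phi> j \<noteq> ?a"
          proof
            assume "\<phi> j = ?a"
            then have "j = y" using \<phi>_\<phi>[of j] a(4) j J UA by auto
            then show False using J(4)[of j] j n y by auto
          qed
          then show ?thesis using j by auto
        qed
        show "\<phi> j \<in> U \<union> ?O" if "j \<in> insert ?a J" "j \<noteq> e" for j using that J(4) a(4) y by auto
        show "\<exists>!j. j \<in> insert ?a J \<and> j \<in> orbit \<tau> d" if "d \<in> U \<union> ?O" for d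
        proof (cases "d \<in> U")
          case True
          have "?a \<notin> orbit \<tau> d" using orbit_subset_closed[of U \<tau>, OF U(2) True] n by auto
          then show ?thesis using J(5)[OF True] by auto
        next
          case False
          then show ?thesis using orb_uniq[OF a(1), of "insert ?a J" d] OU J(1) aO that by auto
        qed
      qed
      then have "card (U \<union> ?O) \<le> card U" using p(2) UJ by fastforce
      moreover have "finite (U \<union> ?O)" using UA orbit_in[OF a(1)] finite_A by (auto intro: finite_subset)
      ultimately have "U = U \<union> ?O" by (intro card_seteq) auto
      then show False using aO n by auto
    qed
  qed
  then have "U = ?K" using U K' by auto
  then have "J \<subseteq> ?K \<inter> H" "\<forall>d\<in>?K. \<exists>!j. j \<in> J \<and> j \<in> orbit \<tau> d" using J(1,2,5) by blast+
  moreover have "\<forall>j\<in>J. \<phi> j \<notin> J" using J(3) by simp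
  ultimately show ?thesis by (intro exI[of _ J] conjI)
qed

text \<open>The choices in the single components give each vertex an edge of its own, and
  \<open>card\<close> says that there are as many edges as vertices, so every edge is owned.\<close>

lemma ex_transversal:
  assumes H: "H \<subseteq> A" "\<And>d. d \<in> H \<Longrightarrow> \<phi> d \<in> H"
    and e: "\<And>d. d \<in> A \<Longrightarrow> \<exists>e \<in> reach \<tau> \<phi> H d \<inter> H. \<phi> e \<in> reach \<tau> \<phi> (H - {e, \<phi> e}) e"
    and card: "2 * card (orbit \<tau> ` A) = card H"
  shows "transversals H \<noteq> {}"
proof -
  define t where "t K = (SOME J. J \<subseteq> K \<inter> H \<and> (\<forall>j\<in>J. \<phi> j \<notin> J) \<and> (\<forall>d\<in>K. \<exists>!j. j \<in> J \<and> j \<in> orbit \<tau> d))" for K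
  let ?c = "reach \<tau> \<phi> H"
  have t: "t (?c d) \<subseteq> ?c d \<inter> H" "\<And>j. j \<in> t (?c d) \<Longrightarrow> \<phi> j \<notin> t (?c d)"
    "\<And>x. x \<in> ?c d \<Longrightarrow> \<exists>!j. j \<in> t (?c d) \<and> j \<in> orbit \<tau> x" if d: "d \<in> A" for d
  proof -
    obtain b where b: "b \<in> ?c d \<inter> H" "\<phi> b \<in> reach \<tau> \<phi> (H - {b, \<phi> b}) b" using e[OF d] by blast
    have "\<exists>J. J \<subseteq> ?c d \<inter> H \<and> (\<forall>j\<in>J. \<phi> j \<notin> J) \<and> (\<forall>x\<in>?c d. \<exists>!j. j \<in> J \<and> j \<in> orbit \<tau> x)"
      using class_transversal[OF H d _ _ b(2)] b(1) by simp
    from someI_ex[OF this] have "t (?c d) \<subseteq> ?c d \<inter> H \<and> (\<forall>j\<in>t (?c d). \<phi> j \<notin> t (?c d)) \<and>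
      (\<forall>x\<in>?c d. \<exists>!j. j \<in> t (?c d) \<and> j \<in> orbit \<tau> x)" unfolding t_def .
    then show "t (?c d) \<subseteq> ?c d \<inter> H" "\<And>j. j \<in> t (?c d) \<Longrightarrow> \<phi> j \<notin> t (?c d)"
      "\<And>x. x \<in> ?c d \<Longrightarrow> \<exists>!j. j \<in> t (?c d) \<and> j \<in> orbit \<tau> x" by auto
  qed
  define J where "J = (\<Union>d\<in>A. t (?c d))"
  have JH: "J \<subseteq> H" using t(1) by (auto simp: J_def)
  have Jc: "j \<in> t (?c d)" if j: "j \<in> J" "d \<in> A" "j \<in> ?c d" for j d
  proof -
    obtain b where b: "b \<in> A" "j \<in> t (?c b)" using j(1) by (auto simp: J_def)
    then have "j \<in> ?c b" using t(1) by auto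
    then have "?c b = ?c d" using reach_eq[OF H(2)] j b by metis
    then show ?thesis using b by simp
  qed
  have J\<phi>: "\<phi> j \<notin> J" if j: "j \<in> J" for j
  proof
    assume p: "\<phi> j \<in> J"
    have jH: "j \<in> H" "j \<in> A" using j JH H by auto
    then have "j \<in> ?c j" "\<phi> j \<in> ?c j" by (auto intro: reach_refl reach_\<phi>)
    then show False using Jc[OF j jH(2)] Jc[OF p jH(2)] t(2)[OF jH(2)] by auto
  qed
  have J1: "\<exists>!j. j \<in> J \<and> j \<in> orbit \<tau> d" if d: "d \<in> A" for d
  proof -
    have "orbit \<tau> d \<subseteq> ?c d" by (rule orbit_subset_closed) (auto intro: reach_refl reach_f)
    then have "j \<in> J \<and> j \<in> orbit \<tau> d \<longleftrightarrow> j \<in> t (?c d) \<and> j \<in> orbit \<tau> d" for j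
      using Jc[OF _ d] d by (auto simp: J_def)
    then show ?thesis using t(3)[OF d reach_refl] by simp
  qed
  have "bij_betw (orbit \<tau>) J (orbit \<tau> ` A)"
  proof (intro bij_betw_imageI inj_onI)
    fix j j' assume j: "j \<in> J" "j' \<in> J" "orbit \<tau> j = orbit \<tau> j'"
    then have "j \<in> A" "j' \<in> A" using JH H by auto
    then show "j = j'" using J1[of j] self_orbit[of j] self_orbit[of j'] j by auto
  next
    show "orbit \<tau> ` J = orbit \<tau> ` A"
    proof (intro set_eqI iffI)
      fix o' assume "o' \<in> orbit \<tau> ` A"
      then obtain d where d: "d \<in> A" "o' = orbit \<tau> d" by auto
      then obtain j where "j \<in> J" "j \<in> orbit \<tau> d" using J1 by blast
      then show "o' \<in> orbit \<tau> ` J" using orbit_eq[OF d(1)] d(2) by (metis imageI)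
    qed (use JH H in auto)
  qed
  then have cJ: "card J = card (orbit \<tau> ` A)" by (rule bij_betw_same_card)
  have finH: "finite H" using H finite_A finite_subset by auto
  have finJ: "finite J" using JH finH finite_subset by auto
  have "inj_on \<phi> J" using bij_\<phi> JH H by (meson bij_betw_def inj_on_subset order_trans)
  then have "card (J \<union> \<phi> ` J) = 2 * card J"
    using J\<phi> finJ by (subst card_Un_disjoint) (auto simp: card_image)
  moreover have "J \<union> \<phi> ` J \<subseteq> H" using JH H by auto
  ultimately have all: "J \<union> \<phi> ` J = H" using card cJ finH by (intro card_seteq) auto
  have "d \<in> J \<longleftrightarrow> \<phi> d \<notin> J" if d: "d \<in> H" for d
  proof
    assume n: "\<phi> d \<notin> J"
    show "d \<in> J"
    proof (rule ccontr)
      assume "d \<notin> J"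
      then obtain j where j: "j \<in> J" "d = \<phi> j" using all d by blast
      then have "\<phi> d = j" using \<phi>_\<phi> JH H by auto
      then show False using n j by simp
    qed
  qed (rule J\<phi>)
  then have "J \<in> transversals H" using JH J1 by (auto simp: transversals_def)
  then show ?thesis by auto
qed

end

text \<open>\<open>nonsep\<close> expresses that the dual graph stays connected when the edges
  crossing any one cycle are removed; \<open>card\<close> says that the rest of the dual graph has
  as many edges as vertices.\<close>

theorem (in rooted_ribbon) card_dual_transversals:
  assumes nonsep: "\<And>C K. C \<in> cyclic_orbits par I \<Longrightarrow> K \<subseteq> A \<Longrightarrow> K \<noteq> {} \<Longrightarrow>
      (\<And>d. d \<in> K \<Longrightarrow> \<tau> (\<phi> d) \<in> K) \<Longrightarrow>
      (\<And>d. d \<in> K \<Longrightarrow> d \<notin> C \<Longrightarrow> \<phi> d \<notin> C \<Longrightarrow> \<phi> d \<in> K) \<Longrightarrow> K = A"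
    and card: "2 * card (orbit (\<tau> \<circ> \<phi>) ` A) = card (A - S)"
  shows "card (ribbon_map.transversals A (\<tau> \<circ> \<phi>) \<phi> (A - S)) = 2 ^ card (cyclic_orbits par I)"
proof -
  interpret dual: ribbon_map A "\<tau> \<circ> \<phi>" \<phi> by (rule dual)
  have "dual.transversals (A - S) \<noteq> {}"
  proof (rule dual.ex_transversal[OF _ _ _ card])
    show "\<phi> d \<in> A - S" if "d \<in> A - S" for d using that \<phi>_in \<phi>_S \<phi>_\<phi> by (metis Diff_iff)
    show "\<exists>e \<in> reach (\<tau> \<circ> \<phi>) \<phi> (A - S) d \<inter> (A - S). \<phi> e \<in> reach (\<tau> \<circ> \<phi>) \<phi> (A - S - {e, \<phi> e}) e"
      if "d \<in> A" for d
      by (rule ex_nonbridge[OF nonsep that])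
  qed simp
  then obtain J where "J \<in> dual.transversals (A - S)" by auto
  then show ?thesis using card_dual_transversals_stable card_stable_sets[OF finite_I par_image] by simp
qed

section \<open>Trinities\<close>

locale trinity_colour =
  fixes T :: "'d tri_map" and X :: colour
  assumes trinity: "trinity T"
begin

abbreviation \<nu> where "\<nu> \<equiv> nxt T"
abbreviation \<phi> where "\<phi> \<equiv> flip T"
abbreviation col where "col d \<equiv> colouring T (vertex_of T d)"

lemma finite_darts: "finite (darts T)"
  and bij_\<nu>: "bij_betw \<nu> (darts T) (darts T)"
  and \<phi>_dart: "d \<in> darts T \<Longrightarrow> \<phi> d \<in> darts T"
  and \<phi>_\<phi>: "d \<in> darts T \<Longrightarrow> \<phi> (\<phi> d) = d"
  and \<phi>_neq: "d \<in> darts T \<Longrightarrow> \<phi> d \<noteq> d"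
  and card_triangle: "d \<in> darts T \<Longrightarrow> card (triangle_of T d) = 3"
  and col_\<phi>_neq: "d \<in> darts T \<Longrightarrow> col d \<noteq> col (\<phi> d)"
  using trinity by (auto simp: trinity_def triangles_def)

lemma \<nu>_dart: "d \<in> darts T \<Longrightarrow> \<nu> d \<in> darts T"
  using bij_\<nu> by (auto simp: bij_betw_def)

lemma \<nu>_inj: "d \<in> darts T \<Longrightarrow> e \<in> darts T \<Longrightarrow> \<nu> d = \<nu> e \<longleftrightarrow> d = e"
  using bij_\<nu> by (auto simp: bij_betw_def inj_on_def)

text \<open>An orbit of three points excludes fixed points and cycles of length two, which leaves
  \<open>\<nu> (\<nu> (\<nu> d)) = d\<close>.\<close>

lemma triangle_eq: "d \<in> darts T \<Longrightarrow> triangle_of T d = {d, \<nu> d, \<nu> (\<nu> d)}"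
  and \<nu>3: "d \<in> darts T \<Longrightarrow> \<nu> (\<nu> (\<nu> d)) = d"
proof -
  assume d: "d \<in> darts T"
  have self: "d \<in> orbit \<nu> d" by (rule bij_betw_self_in_orbit[OF finite_darts bij_\<nu> d])
  have c: "card (orbit \<nu> d) = 3" using card_triangle[OF d] by (simp add: triangle_of_def)
  have 1: "\<nu> d \<noteq> d"
  proof
    assume "\<nu> d = d"
    then have "orbit \<nu> d = {d}" by (simp add: orbit_eq_singleton_iff)
    then show False using c by simp
  qed
  have 2: "\<nu> (\<nu> d) \<noteq> d"
  proof
    assume "\<nu> (\<nu> d) = d"
    then have "(\<nu> ^^ 2) d = d" by (simp add: numeral_2_eq_2)
    then have "orbit \<nu> d = {(\<nu> ^^ m) d |m. m < 2}" by (rule orbit_altdef_bounded) simp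
    then have "orbit \<nu> d \<subseteq> {d, \<nu> d}" by (auto simp: less_2_cases_iff)
    then have "card (orbit \<nu> d) \<le> card {d, \<nu> d}" by (rule card_mono[rotated]) simp
    also have "\<dots> \<le> 2" by (simp add: card_insert_le_m1)
    finally have "card (orbit \<nu> d) \<le> 2" .
    then show False using c by simp
  qed
  have nn: "\<nu> (\<nu> d) \<noteq> \<nu> d" using 1 \<nu>_inj d \<nu>_dart by auto
  have sub: "{d, \<nu> d, \<nu> (\<nu> d)} \<subseteq> orbit \<nu> d" using self by (auto intro: orbit.intros)
  have c3: "card {d, \<nu> d, \<nu> (\<nu> d)} = 3" using 1 2 nn by auto
  have "finite (orbit \<nu> d)" using c card.infinite by fastforce
  then have eq: "{d, \<nu> d, \<nu> (\<nu> d)} = orbit \<nu> d" using sub c c3 by (intro card_seteq) auto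
  then show "triangle_of T d = {d, \<nu> d, \<nu> (\<nu> d)}" by (simp add: triangle_of_def)
  have "\<nu> (\<nu> (\<nu> d)) \<in> orbit \<nu> d" by (intro orbit.intros)
  then have "\<nu> (\<nu> (\<nu> d)) \<in> {d, \<nu> d, \<nu> (\<nu> d)}" using eq by simp
  then show "\<nu> (\<nu> (\<nu> d)) = d" using 1 2 nn \<nu>_inj d \<nu>_dart by auto
qed

lemma rot_dart: "d \<in> darts T \<Longrightarrow> rot T d \<in> darts T"
  by (simp add: rot_def \<phi>_dart \<nu>_dart)

lemma bij_rot: "bij_betw (rot T) (darts T) (darts T)"
proof -
  have "bij_betw \<phi> (darts T) (darts T)"
    by (rule bij_betwI[of \<phi> _ _ \<phi>]) (auto simp: \<phi>_dart \<phi>_\<phi>)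
  then have "bij_betw (\<nu> \<circ> \<phi>) (darts T) (darts T)" using bij_\<nu> by (rule bij_betw_trans)
  moreover have "rot T = \<nu> \<circ> \<phi>" by (auto simp: rot_def)
  ultimately show ?thesis by simp
qed

lemma self_vertex: "d \<in> darts T \<Longrightarrow> d \<in> vertex_of T d"
  unfolding vertex_of_def by (rule bij_betw_self_in_orbit[OF finite_darts bij_rot])

lemma vertex_rot: "d \<in> darts T \<Longrightarrow> vertex_of T (rot T d) = vertex_of T d"
  unfolding vertex_of_def by (rule self_in_orbit_step[OF bij_betw_self_in_orbit[OF finite_darts bij_rot]])

lemma vertex_\<nu>: "d \<in> darts T \<Longrightarrow> vertex_of T (\<nu> d) = vertex_of T (\<phi> d)"
  using vertex_rot[OF \<phi>_dart] by (simp add: rot_def \<phi>_\<phi>)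

lemma col_neq:
  assumes "d \<in> darts T"
  shows "col d \<noteq> col (\<nu> d)" "col d \<noteq> col (\<nu> (\<nu> d))" "col (\<nu> d) \<noteq> col (\<nu> (\<nu> d))"
proof -
  have "col e \<noteq> col (\<nu> e)" if "e \<in> darts T" for e using col_\<phi>_neq[OF that] vertex_\<nu>[OF that] by simp
  from this[of d] this[of "\<nu> d"] this[of "\<nu> (\<nu> d)"]
  show "col d \<noteq> col (\<nu> d)" "col d \<noteq> col (\<nu> (\<nu> d))" "col (\<nu> d) \<noteq> col (\<nu> (\<nu> d))"
    using assms \<nu>_dart \<nu>3 by auto
qed

lemma triangle_\<nu>: "d \<in> darts T \<Longrightarrow> triangle_of T (\<nu> d) = triangle_of T d"
  using triangle_eq[of d] triangle_eq[of "\<nu> d"] \<nu>_dart \<nu>3 by auto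

lemma triangle_eq_if_in: "d \<in> darts T \<Longrightarrow> e \<in> triangle_of T d \<Longrightarrow> triangle_of T e = triangle_of T d"
  using triangle_eq[of d] triangle_\<nu>[of d] triangle_\<nu>[of "\<nu> d"] \<nu>_dart by auto

definition is_white :: "'d \<Rightarrow> bool" where "is_white d \<longleftrightarrow> \<not> black T (triangle_of T d)"

text \<open>The counterclockwise order of the colours around a black triangle.\<close>

fun next_colour :: "colour \<Rightarrow> colour" where
  "next_colour Blue = Red" | "next_colour Red = Green" | "next_colour Green = Blue"

text \<open>The three corners have different colours, so one step of the cyclic order decides all of
  it.\<close>

lemma black_iff:
  assumes d: "d \<in> darts T"
  shows "black T (triangle_of T d) \<longleftrightarrow> col (\<nu> d) = next_colour (col d)"
proof -
  have "black T (triangle_of T d) \<longleftrightarrow>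
    (col d = Blue \<and> col (\<nu> d) = Red \<and> col (\<nu> (\<nu> d)) = Green) \<or>
    (col (\<nu> d) = Blue \<and> col (\<nu> (\<nu> d)) = Red \<and> col d = Green) \<or>
    (col (\<nu> (\<nu> d)) = Blue \<and> col d = Red \<and> col (\<nu> d) = Green)"
    unfolding black_def triangle_eq[OF d] using \<nu>3[OF d] \<nu>3[OF \<nu>_dart[OF d]] by simp
  then show ?thesis using col_neq[OF d]
    by (cases "col d"; cases "col (\<nu> d)"; cases "col (\<nu> (\<nu> d))") auto
qed

text \<open>Reversing a dart exchanges the colours of its ends, so one of the two directions agrees
  with \<open>next_colour\<close> and the other does not.\<close>

lemma white_\<phi>:
  assumes d: "d \<in> darts T"
  shows "is_white (\<phi> d) \<longleftrightarrow> \<not> is_white d"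
proof -
  have "vertex_of T (\<nu> (\<phi> d)) = vertex_of T d" "vertex_of T (\<phi> d) = vertex_of T (\<nu> d)"
    using vertex_\<nu>[OF \<phi>_dart[OF d]] \<phi>_\<phi>[OF d] vertex_\<nu>[OF d] by auto
  then show ?thesis
    unfolding is_white_def black_iff[OF d] black_iff[OF \<phi>_dart[OF d]] using col_neq(1)[OF d]
    by (cases "col d"; cases "col (\<nu> d)") auto
qed

text \<open>The common half-edges of \<open>G_X^*\<close> and its dual. Each triangle contains
  exactly one of them, on the side opposite to its corner of colour \<open>X\<close>, so they also
  enumerate the triangles.\<close>

definition xdarts :: "'d set" where "xdarts = {d \<in> darts T. edge_of T d \<in> edges_of_colour T X}"

lemma xdarts_dart: "d \<in> xdarts \<Longrightarrow> d \<in> darts T" by (simp add: xdarts_def)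

lemma xdarts_iff_col: "d \<in> darts T \<Longrightarrow> d \<in> xdarts \<longleftrightarrow> col d \<noteq> X \<and> col (\<nu> d) \<noteq> X"
  using vertex_\<nu>[of d] by (auto simp: xdarts_def edges_of_colour_def edges_def edge_of_def)

lemma xdarts_iff: "d \<in> darts T \<Longrightarrow> d \<in> xdarts \<longleftrightarrow> col (\<nu> (\<nu> d)) = X"
  unfolding xdarts_iff_col using col_neq[of d]
  by (cases "col d"; cases "col (\<nu> d)"; cases "col (\<nu> (\<nu> d))"; cases X) auto

lemma edge_\<phi>: "d \<in> darts T \<Longrightarrow> edge_of T (\<phi> d) = edge_of T d"
  using \<phi>_\<phi>[of d] by (auto simp: edge_of_def)

lemma xdarts_\<phi>: "d \<in> xdarts \<Longrightarrow> \<phi> d \<in> xdarts"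
  by (simp add: xdarts_def edge_\<phi> \<phi>_dart)

lemma xdarts_neq:
  assumes "d \<in> xdarts" shows "\<nu> d \<notin> xdarts" "\<nu> (\<nu> d) \<notin> xdarts"
proof -
  have d: "d \<in> darts T" "col (\<nu> (\<nu> d)) = X" using assms xdarts_dart xdarts_iff by auto
  then have "col (\<nu> (\<nu> (\<nu> d))) \<noteq> X" "col (\<nu> (\<nu> (\<nu> (\<nu> d)))) \<noteq> X"
    using \<nu>3 \<nu>_dart col_neq[OF d(1)] by auto
  then show "\<nu> d \<notin> xdarts" "\<nu> (\<nu> d) \<notin> xdarts" using xdarts_iff d \<nu>_dart by auto
qed

lemma triangle_xdart:
  assumes d: "d \<in> darts T" shows "\<exists>e \<in> xdarts. triangle_of T e = triangle_of T d"
proof -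
  have "col d = X \<or> col (\<nu> d) = X \<or> col (\<nu> (\<nu> d)) = X"
    using col_neq[OF d] by (cases "col d"; cases "col (\<nu> d)"; cases "col (\<nu> (\<nu> d))"; cases X) auto
  then have "\<nu> d \<in> xdarts \<or> \<nu> (\<nu> d) \<in> xdarts \<or> d \<in> xdarts"
    using xdarts_iff d \<nu>_dart \<nu>3 by auto
  moreover have "triangle_of T (\<nu> d) = triangle_of T d" "triangle_of T (\<nu> (\<nu> d)) = triangle_of T d"
    using triangle_\<nu> d \<nu>_dart by auto
  ultimately show ?thesis by blast
qed

lemma triangle_xdart_unique:
  assumes "d \<in> xdarts" "e \<in> xdarts" "triangle_of T e = triangle_of T d" shows "e = d"
proof -
  have "e \<in> {d, \<nu> d, \<nu> (\<nu> d)}" using assms triangle_eq[of d] triangle_eq[of e] xdarts_dart by auto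
  then show ?thesis using xdarts_neq[OF assms(1)] assms(2) by auto
qed

text \<open>The rotation of \<open>G\<^sub>X\<^sup>*\<close> around its vertices; a half-edge is named by the dart it crosses.\<close>

definition \<tau> :: "'d \<Rightarrow> 'd" where "\<tau> d = \<nu> (\<phi> (\<nu> d))"

lemma \<tau>_xdart:
  assumes d: "d \<in> xdarts" shows "\<tau> d \<in> xdarts"
proof -
  have D: "d \<in> darts T" "\<nu> d \<in> darts T" "\<phi> (\<nu> d) \<in> darts T" "\<tau> d \<in> darts T"
    using d xdarts_dart \<nu>_dart \<phi>_dart by (auto simp: \<tau>_def)
  have "col (\<nu> (\<nu> (\<tau> d))) = col (\<phi> (\<nu> d))" using \<nu>3 D by (simp add: \<tau>_def)
  also have "\<dots> = X" using vertex_\<nu>[OF D(2)] xdarts_iff d D by simp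
  finally show ?thesis using xdarts_iff D by simp
qed

sublocale map: ribbon_map xdarts \<tau> \<phi>
proof
  show fin: "finite xdarts" using finite_darts by (simp add: xdarts_def)
  have "inj_on \<tau> xdarts"
  proof (rule inj_onI)
    fix d e assume "d \<in> xdarts" "e \<in> xdarts" "\<tau> d = \<tau> e"
    moreover from this have "\<phi> (\<nu> d) = \<phi> (\<nu> e)" using \<nu>_inj \<nu>_dart \<phi>_dart xdarts_dart by (auto simp: \<tau>_def)
    ultimately show "d = e" using \<phi>_\<phi> \<nu>_dart \<nu>_inj xdarts_dart by metis
  qed
  then show "bij_betw \<tau> xdarts xdarts"
    using endo_inj_surj[OF fin] \<tau>_xdart by (auto simp: bij_betw_def)
qed (auto simp: xdarts_\<phi> \<phi>_\<phi> \<phi>_neq xdarts_dart)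

definition apex :: "'d \<Rightarrow> 'd set" where "apex d = vertex_of T (\<nu> (\<nu> d))"

text \<open>\<open>\<tau>\<close> and \<open>rot T\<close> turn in opposite senses around the
  apex.\<close>

lemma rot_apex: 
  assumes d: "d \<in> xdarts" shows "rot T (\<nu> (\<nu> (\<tau> d))) = \<nu> (\<nu> d)"
proof -
  have D: "d \<in> darts T" "\<nu> d \<in> darts T" "\<phi> (\<nu> d) \<in> darts T"
    using d xdarts_dart \<nu>_dart \<phi>_dart by auto
  show ?thesis using \<nu>3[OF D(3)] \<phi>_\<phi>[OF D(2)] by (simp add: \<tau>_def rot_def)
qed

lemma orbit_\<tau>_iff:
  assumes d: "d \<in> xdarts" "e \<in> xdarts"
  shows "e \<in> orbit \<tau> d \<longleftrightarrow> apex e = apex d"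
proof
  assume "e \<in> orbit \<tau> d"
  moreover have apex_\<tau>: "apex (\<tau> x) = apex x" if "x \<in> xdarts" for x
    using vertex_rot[of "\<nu> (\<nu> (\<tau> x))"] rot_apex[OF that] \<tau>_xdart[OF that] \<nu>_dart xdarts_dart
    by (auto simp: apex_def)
  ultimately show "apex e = apex d"
  proof induct
    case (step y)
    then show ?case using map.orbit_in[OF d(1)] by auto
  qed (use d in auto)
next
  assume "apex e = apex d"
  then have "\<nu> (\<nu> e) \<in> orbit (rot T) (\<nu> (\<nu> d))"
    using self_vertex[of "\<nu> (\<nu> e)"] d \<nu>_dart xdarts_dart by (auto simp: apex_def vertex_of_def)
  \<comment> \<open>Following \<open>rot T\<close> around the apex means following
    \<open>\<tau>\<close> backwards, which stays in the orbit as \<open>\<tau>\<close> permutes a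
    finite set.\<close>
  moreover have pred: "\<nu> (rot T (\<nu> (\<nu> y))) \<in> orbit \<tau> d" if y: "y \<in> orbit \<tau> d" for y
  proof -
    have yA: "y \<in> xdarts" using y map.orbit_in[OF d(1)] by auto
    obtain z where z: "z \<in> xdarts" "\<tau> z = y" using map.bij_\<tau> yA by (metis bij_betw_imp_surj_on imageE)
    have "y \<in> orbit \<tau> z" using z orbit.base by metis
    then have "z \<in> orbit \<tau> y" using orbit_swap map.self_orbit[OF z(1)] by fast
    moreover have "\<nu> (rot T (\<nu> (\<nu> y))) = z" using rot_apex[OF z(1)] z \<nu>3 xdarts_dart by simp
    ultimately show ?thesis using y orbit_trans by fast
  qed
  have "\<nu> x \<in> orbit \<tau> d \<and> x \<in> darts T" if "x \<in> orbit (rot T) (\<nu> (\<nu> d))" for x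
    using that
  proof induct
    case base
    show ?case using pred[OF map.self_orbit[OF d(1)]] rot_dart \<nu>_dart xdarts_dart[OF d(1)] by auto
  next
    case (step x)
    have "\<nu> (\<nu> (\<nu> x)) = x" using step \<nu>3 by auto
    then show ?case using pred[of "\<nu> x"] step rot_dart by simp
  qed
  ultimately have "\<nu> (\<nu> (\<nu> e)) \<in> orbit \<tau> d" by blast
  then show "e \<in> orbit \<tau> d" using \<nu>3 d xdarts_dart by simp
qed

text \<open>Around a vertex not of colour \<open>X\<close> the neighbours alternate between
  \<open>X\<close> and the third colour, so every second dart lies on an edge of colour
  \<open>X\<close>.\<close>

lemma rot_xdart:
  assumes d: "d \<in> darts T" "col d \<noteq> X"
  shows "rot T d \<in> xdarts \<longleftrightarrow> d \<notin> xdarts"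
proof -
  have D: "\<phi> d \<in> darts T" "rot T d \<in> darts T" using d \<phi>_dart rot_dart by auto
  have "rot T d \<in> xdarts \<longleftrightarrow> col (\<phi> d) = X"
    using xdarts_iff[OF D(2)] \<nu>3[OF D(1)] by (simp add: rot_def)
  then show ?thesis using xdarts_iff_col[OF d(1)] vertex_\<nu>[OF d(1)] d(2) by auto
qed

lemma col_xdart: "d \<in> xdarts \<Longrightarrow> col d \<noteq> X"
  using xdarts_iff_col xdarts_dart by auto

lemma rot_rot: "\<tau> (\<phi> d) = rot T (rot T d)" by (simp add: rot_def \<tau>_def)

text \<open>One step of \<open>\<tau> \<circ> \<phi>\<close> is two steps of \<open>rot T\<close>,
  which lead from one dart in \<open>xdarts\<close> at the vertex to the next.\<close>

lemma orbit_\<sigma>_iff: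
  assumes d: "d \<in> xdarts" "e \<in> xdarts"
  shows "e \<in> orbit (\<tau> \<circ> \<phi>) d \<longleftrightarrow> vertex_of T e = vertex_of T d"
proof
  assume "e \<in> orbit (\<tau> \<circ> \<phi>) d"
  moreover have "vertex_of T (\<tau> (\<phi> x)) = vertex_of T x \<and> \<tau> (\<phi> x) \<in> xdarts" if "x \<in> xdarts" for x
    using that \<tau>_xdart xdarts_\<phi> vertex_rot xdarts_dart rot_dart by (simp add: rot_rot[symmetric]) (simp add: rot_rot)
  ultimately have "vertex_of T e = vertex_of T d \<and> e \<in> xdarts"
    by induct (use d in auto)
  then show "vertex_of T e = vertex_of T d" by simp
next
  assume "vertex_of T e = vertex_of T d"
  then have "e \<in> orbit (rot T) d" using self_vertex[of e] d xdarts_dart by (auto simp: vertex_of_def)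
  \<comment> \<open>A dart outside \<open>xdarts\<close> is represented by its successor, so that
    the claim passes through single steps of \<open>rot T\<close>.\<close>
  moreover have "x \<in> darts T \<and> col x \<noteq> X \<and> (if x \<in> xdarts then x else rot T x) \<in> orbit (\<tau> \<circ> \<phi>) d"
    if "x \<in> orbit (rot T) d" for x
    using that
  proof induct
    case base
    have "rot T d \<notin> xdarts" using rot_xdart[of d] d xdarts_dart col_xdart by auto
    moreover have "rot T (rot T d) \<in> orbit (\<tau> \<circ> \<phi>) d"
      using orbit.base[of "\<tau> \<circ> \<phi>" d] by (simp only: comp_apply rot_rot)
    ultimately show ?case using d xdarts_dart rot_dart vertex_rot col_xdart by (auto simp: o_def)
  next
    case (step x)
    have "rot T x \<in> darts T" "col (rot T x) \<noteq> X" using step rot_dart vertex_rot by auto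
    moreover have "x \<in> xdarts \<Longrightarrow> rot T (rot T x) \<in> orbit (\<tau> \<circ> \<phi>) d"
      using step orbit.step[of x "\<tau> \<circ> \<phi>" d] by (simp add: rot_rot[symmetric] o_def)
    ultimately show ?case using step rot_xdart[of x] by (auto simp: o_def)
  qed
  ultimately show "e \<in> orbit (\<tau> \<circ> \<phi>) d" using d by (metis (full_types))
qed

end

section \<open>Sides of edges, ends of arcs, and the numbers of triangles and edges\<close>

context trinity_colour begin

lemma white_triangle_iff: "d \<in> darts T \<Longrightarrow> triangle_of T d \<in> white_triangles T \<longleftrightarrow> is_white d"
  by (auto simp: white_triangles_def triangles_def is_white_def)

lemma black_triangle_iff: "d \<in> darts T \<Longrightarrow> triangle_of T d \<in> black_triangles T \<longleftrightarrow> \<not> is_white d"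
  by (auto simp: black_triangles_def triangles_def is_white_def)

lemma triangle_self: "d \<in> darts T \<Longrightarrow> d \<in> triangle_of T d"
  using triangle_eq by auto

lemma triangle_meets_edge:
  assumes "t \<in> triangles T" "t \<inter> edge_of T d \<noteq> {}"
  shows "t = triangle_of T d \<or> t = triangle_of T (\<phi> d)"
proof -
  obtain x where x: "x \<in> darts T" "t = triangle_of T x" using assms(1) by (auto simp: triangles_def)
  obtain y where "y \<in> t" "y = d \<or> y = \<phi> d" using assms(2) by (auto simp: edge_of_def)
  then show ?thesis using triangle_eq_if_in[OF x(1)] x(2) by auto
qed

lemma white_side_eq:
  assumes d: "d \<in> darts T" "is_white d" shows "white_side T (edge_of T d) = triangle_of T d"
  unfolding white_side_def
proof (rule the_equality)
  show "triangle_of T d \<in> white_triangles T \<and> triangle_of T d \<inter> edge_of T d \<noteq> {}"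
    using d white_triangle_iff triangle_self by (auto simp: edge_of_def)
next
  fix t assume t: "t \<in> white_triangles T \<and> t \<inter> edge_of T d \<noteq> {}"
  then have "t = triangle_of T d \<or> t = triangle_of T (\<phi> d)"
    using triangle_meets_edge by (auto simp: white_triangles_def)
  then show "t = triangle_of T d"
    using t white_triangle_iff[OF \<phi>_dart[OF d(1)]] white_\<phi>[OF d(1)] d(2) by auto
qed

lemma black_side_eq:
  assumes d: "d \<in> darts T" "is_white d" shows "black_side T (edge_of T d) = triangle_of T (\<phi> d)"
  unfolding black_side_def
proof (rule the_equality)
  show "triangle_of T (\<phi> d) \<in> black_triangles T \<and> triangle_of T (\<phi> d) \<inter> edge_of T d \<noteq> {}"
    using d black_triangle_iff triangle_self[OF \<phi>_dart] white_\<phi> \<phi>_dart by (auto simp: edge_of_def)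
next
  fix t assume t: "t \<in> black_triangles T \<and> t \<inter> edge_of T d \<noteq> {}"
  then have "t = triangle_of T d \<or> t = triangle_of T (\<phi> d)"
    using triangle_meets_edge by (auto simp: black_triangles_def)
  then show "t = triangle_of T (\<phi> d)" using t black_triangle_iff[OF d(1)] d(2) by auto
qed

lemma col_apex: "d \<in> xdarts \<Longrightarrow> colouring T (apex d) = X"
  using xdarts_iff xdarts_dart by (auto simp: apex_def)

lemma col_xdart_\<phi>: "d \<in> xdarts \<Longrightarrow> col (\<phi> d) \<noteq> X"
  using col_xdart xdarts_\<phi> by blast

lemma vertices_triangle: "d \<in> darts T \<Longrightarrow> vertex_of T ` triangle_of T d = {vertex_of T d, vertex_of T (\<phi> d), apex d}"
  using triangle_eq[of d] vertex_\<nu>[of d] by (auto simp: apex_def)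

lemma corner_eq:
  assumes d: "d \<in> xdarts" shows "corner T X (triangle_of T d) = apex d"
  unfolding corner_def vertices_triangle[OF xdarts_dart[OF d]]
  using col_apex[OF d] col_xdart[OF d] col_xdart_\<phi>[OF d] by (intro the_equality) auto

text \<open>The triangle on the left of the white dart is the white one, whose corner of colour
  \<open>X\<close> is the apex of that dart.\<close>

lemma head_edge:
  assumes "d \<in> xdarts" "is_white d" shows "head (dual_graph T X) (edge_of T d) = apex d"
  using assms white_side_eq corner_eq xdarts_dart by (simp add: dual_graph_def)

lemma tail_edge:
  assumes "d \<in> xdarts" "is_white d" shows "tail (dual_graph T X) (edge_of T d) = apex (\<phi> d)"
  using assms black_side_eq corner_eq xdarts_dart xdarts_\<phi> by (simp add: dual_graph_def)

lemma edge_white_xdart: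
  assumes "e \<in> edges_of_colour T X" shows "\<exists>d \<in> xdarts. is_white d \<and> e = edge_of T d"
proof -
  obtain d where d: "d \<in> darts T" "e = edge_of T d" using assms by (auto simp: edges_of_colour_def edges_def)
  then have "d \<in> xdarts" using assms by (simp add: xdarts_def)
  then show ?thesis using d white_\<phi>[OF d(1)] edge_\<phi>[OF d(1)] xdarts_\<phi> by metis
qed

lemma edge_eq_white:
  assumes "d \<in> darts T" "e \<in> darts T" "is_white d" "is_white e" "edge_of T d = edge_of T e"
  shows "d = e"
proof -
  have "d = e \<or> d = \<phi> e" using assms(5) by (auto simp: edge_of_def)
  then show ?thesis using assms white_\<phi>[of e] by auto
qed

lemma vertex_of_colour_xdart:
  assumes "v \<in> vertices T" "colouring T v = X" shows "\<exists>d \<in> xdarts. v = apex d"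
proof -
  obtain x where x: "x \<in> darts T" "v = vertex_of T x" using assms by (auto simp: vertices_def)
  then have "\<nu> x \<in> xdarts" "apex (\<nu> x) = v"
    using assms(2) xdarts_iff[OF \<nu>_dart[OF x(1)]] \<nu>3 by (auto simp: apex_def)
  then show ?thesis by auto
qed

lemma vertex_not_colour_xdart:
  assumes "v \<in> vertices T" "colouring T v \<noteq> X" shows "\<exists>d \<in> xdarts. v = vertex_of T d"
proof -
  obtain x where x: "x \<in> darts T" "v = vertex_of T x" using assms by (auto simp: vertices_def)
  then show ?thesis using rot_xdart[of x] vertex_rot[of x] assms(2) by auto
qed

lemma apex_vertex: "d \<in> xdarts \<Longrightarrow> apex d \<in> vertices T"
  using xdarts_dart \<nu>_dart by (auto simp: apex_def vertices_def)

lemma vertex_vertex: "d \<in> xdarts \<Longrightarrow> vertex_of T d \<in> vertices T"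
  using xdarts_dart by (auto simp: vertices_def)

lemma card_triangles: "card (triangles T) = card xdarts"
proof -
  have "bij_betw (triangle_of T) xdarts (triangles T)"
  proof (intro bij_betw_imageI inj_onI)
    show "triangle_of T ` xdarts = triangles T"
    proof (intro set_eqI iffI)
      fix t assume "t \<in> triangles T"
      then obtain d where "d \<in> darts T" "t = triangle_of T d" by (auto simp: triangles_def)
      then show "t \<in> triangle_of T ` xdarts" using triangle_xdart by (metis imageI)
    qed (auto simp: triangles_def xdarts_dart)
  qed (use triangle_xdart_unique in blast)
  then show ?thesis by (simp add: bij_betw_same_card)
qed

text \<open>Both sides count the darts.\<close>

lemma card_edges: "2 * card (edges T) = 3 * card (triangles T)"
proof -
  have "2 * card (edges T) = card (\<Union>(edges T))"
  proof (rule card_partition)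
    show "finite (edges T)" using finite_darts by (simp add: edges_def)
    show "finite (\<Union>(edges T))" using finite_darts by (auto simp: edges_def edge_of_def)
    show "card e = 2" if "e \<in> edges T" for e
      using that \<phi>_neq by (force simp: edges_def edge_of_def card_2_iff)
    show "e \<inter> e' = {}" if e: "e \<in> edges T" "e' \<in> edges T" "e \<noteq> e'" for e e'
    proof -
      have "edge_of T x = b" if "b \<in> edges T" "x \<in> b" for x b
        using that edge_\<phi> by (auto simp: edges_def edge_of_def)
      then show ?thesis using e by blast
    qed
  qed
  moreover have "\<Union>(edges T) = darts T" using \<phi>_dart by (auto simp: edges_def edge_of_def)
  moreover have "3 * card (triangles T) = card (\<Union>(triangles T))"
  proof (rule card_partition)
    show "finite (triangles T)" using finite_darts by (simp add: triangles_def)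
    show "finite (\<Union>(triangles T))" using finite_darts triangle_eq by (auto simp: triangles_def)
    show "card t = 3" if "t \<in> triangles T" for t using that card_triangle by (auto simp: triangles_def)
    show "t \<inter> t' = {}" if t: "t \<in> triangles T" "t' \<in> triangles T" "t \<noteq> t'" for t t'
    proof -
      have "triangle_of T x = b" if "b \<in> triangles T" "x \<in> b" for x b
        using that triangle_eq_if_in by (auto simp: triangles_def)
      then show ?thesis using t by blast
    qed
  qed
  moreover have "\<Union>(triangles T) = darts T" using triangle_eq \<nu>_dart by (auto simp: triangles_def)
  ultimately show ?thesis by simp
qed

end

section \<open>The wreath as a functional graph on the vertices of colour \<open>X\<close>\<close>

locale toric_wreath = trinity_colour T X for T :: "'d tri_map" and X +
  fixes W :: "'d set set"
  assumes euler: "euler_characteristic T = 0" and wreath: "wreath T X W"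
begin

definition S :: "'d set" where "S = {d \<in> xdarts. edge_of T d \<in> W}"
text \<open>The white dart of an edge is the half-edge at the head of its arc. So each vertex of
  colour \<open>X\<close> owns the arc of \<open>W\<close> that ends there, and \<open>par\<close>
  runs against the arcs.\<close>

definition I :: "'d set" where "I = {d \<in> S. is_white d}"

lemma W_arcs: "W \<subseteq> edges_of_colour T X"
  using wreath by (simp add: wreath_def dual_graph_def)

lemma I_xdart: "i \<in> I \<Longrightarrow> i \<in> xdarts" and I_white: "i \<in> I \<Longrightarrow> is_white i" and I_W: "i \<in> I \<Longrightarrow> edge_of T i \<in> W"
  by (auto simp: I_def S_def)

lemma W_I: "e \<in> W \<Longrightarrow> \<exists>i \<in> I. e = edge_of T i"
  using W_arcs edge_white_xdart by (fastforce simp: I_def S_def)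

lemma edge_inj_I: "inj_on (edge_of T) I"
  using edge_eq_white I_xdart I_white xdarts_dart by (auto intro!: inj_onI)

lemma ex1_I: 
  assumes d: "d \<in> xdarts" shows "\<exists>!i. i \<in> I \<and> apex i = apex d"
proof -
  have "apex d \<in> verts (dual_graph T X)"
    using apex_vertex[OF d] col_apex[OF d] by (simp add: dual_graph_def vertices_of_colour_def)
  then have ex1: "\<exists>!e. e \<in> W \<and> head (dual_graph T X) e = apex d" using wreath by (simp add: wreath_def)
  then obtain e where e: "e \<in> W" "head (dual_graph T X) e = apex d" by auto
  obtain i where i: "i \<in> I" "e = edge_of T i" using W_I[OF e(1)] by auto
  show ?thesis
  proof (rule ex1I[of _ i])
    show "i \<in> I \<and> apex i = apex d" using i e head_edge I_xdart I_white by auto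
    fix j assume j: "j \<in> I \<and> apex j = apex d"
    then have "edge_of T j \<in> W" "head (dual_graph T X) (edge_of T j) = apex d"
      using head_edge I_xdart I_white I_W by auto
    then have "edge_of T j = edge_of T i" using ex1 e i(2) by blast
    then show "j = i" using edge_inj_I j i(1) by (auto dest: inj_onD)
  qed
qed

sublocale rooted: rooted_ribbon xdarts \<tau> \<phi> S I
proof
  show "S \<subseteq> xdarts" by (auto simp: S_def)
  show S\<phi>: "\<phi> d \<in> S" if "d \<in> S" for d using that xdarts_\<phi> edge_\<phi> xdarts_dart by (auto simp: S_def)
  show "I \<in> map.transversals S"
    unfolding map.transversals_def
  proof (intro CollectI conjI ballI)
    show "d \<in> I \<longleftrightarrow> \<phi> d \<notin> I" if "d \<in> S" for d
      using that S\<phi>[OF that] white_\<phi>[of d] xdarts_dart by (auto simp: I_def S_def)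
    show "\<exists>!j. j \<in> I \<and> j \<in> orbit \<tau> d" if d: "d \<in> xdarts" for d
      using ex1_I[OF d] orbit_\<tau>_iff[OF d] I_xdart by metis
  qed (auto simp: I_def)
qed

lemma apex_inj_I: "inj_on apex I"
  using ex1_I I_xdart by (auto intro!: inj_onI)

lemma apex_par: "i \<in> I \<Longrightarrow> apex (rooted.par i) = apex (\<phi> i)"
  using rooted.root_orbit[of "\<phi> i"] rooted.root_in[of "\<phi> i"] orbit_\<tau>_iff[of "\<phi> i"] I_xdart xdarts_\<phi>
  by (auto simp: rooted.par_def)

lemma card_vertices: "card (vertices T) = card I + card (orbit (\<tau> \<circ> \<phi>) ` xdarts)"
proof -
  have 1: "{v \<in> vertices T. colouring T v = X} = apex ` I"
  proof (intro set_eqI iffI)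
    fix v assume "v \<in> {v \<in> vertices T. colouring T v = X}"
    then obtain d where "d \<in> xdarts" "v = apex d" using vertex_of_colour_xdart by auto
    then show "v \<in> apex ` I" using ex1_I[of d] by (metis imageI)
  qed (use apex_vertex col_apex I_xdart in auto)
  have 2: "{v \<in> vertices T. colouring T v \<noteq> X} = vertex_of T ` xdarts"
    using vertex_not_colour_xdart vertex_vertex col_xdart by fast
  interpret dual: ribbon_map xdarts "\<tau> \<circ> \<phi>" \<phi> by (rule map.dual)
  have eq: "orbit (\<tau> \<circ> \<phi>) d = vertex_of T d \<inter> xdarts" if d: "d \<in> xdarts" for d
  proof (intro set_eqI iffI)
    fix e assume "e \<in> orbit (\<tau> \<circ> \<phi>) d"
    moreover from this have "e \<in> xdarts" using dual.orbit_in[OF d] by blast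
    ultimately show "e \<in> vertex_of T d \<inter> xdarts" 
      using orbit_\<sigma>_iff[OF d] self_vertex[of e] xdarts_dart by auto
  next
    fix e assume e: "e \<in> vertex_of T d \<inter> xdarts"
    then have "vertex_of T e = vertex_of T d"
      using orbit_eq_if_in[OF bij_betw_self_in_orbit[OF finite_darts bij_rot xdarts_dart[OF d]]]
      by (auto simp: vertex_of_def)
    then show "e \<in> orbit (\<tau> \<circ> \<phi>) d" using orbit_\<sigma>_iff[OF d] e by auto
  qed
  have "bij_betw (\<lambda>v. v \<inter> xdarts) (vertex_of T ` xdarts) (orbit (\<tau> \<circ> \<phi>) ` xdarts)"
  proof (intro bij_betw_imageI inj_onI)
    fix v v' assume v: "v \<in> vertex_of T ` xdarts" "v' \<in> vertex_of T ` xdarts" "v \<inter> xdarts = v' \<inter> xdarts"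
    then obtain d d' where d: "d \<in> xdarts" "v = vertex_of T d" "d' \<in> xdarts" "v' = vertex_of T d'" by auto
    then have "d \<in> orbit (\<tau> \<circ> \<phi>) d'" using v(3) eq dual.self_orbit[of d] by auto
    then show "v = v'" using orbit_\<sigma>_iff d by auto
  qed (use eq in \<open>auto simp: image_image\<close>)
  then have 3: "card (vertex_of T ` xdarts) = card (orbit (\<tau> \<circ> \<phi>) ` xdarts)" by (rule bij_betw_same_card)
  have "vertices T = {v \<in> vertices T. colouring T v = X} \<union> {v \<in> vertices T. colouring T v \<noteq> X}" by auto
  moreover have "finite (vertices T)" using finite_darts by (simp add: vertices_def)
  ultimately have "card (vertices T) = card {v \<in> vertices T. colouring T v = X} + card {v \<in> vertices T. colouring T v \<noteq> X}"
    by (metis (no_types, lifting) card_Un_disjoint disjoint_iff finite_Un mem_Collect_eq)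
  then show ?thesis using 1 2 3 card_image[OF apex_inj_I] by simp
qed

text \<open>Euler characteristic 0 and \<open>card_edges\<close> give twice as many triangles as
  vertices. Removing the vertices of colour \<open>X\<close>, which are counted by \<open>I\<close>,
  and the two half-edges of each arc in \<open>W\<close> keeps this ratio.\<close>

lemma card_\<sigma>_orbits: "2 * card (orbit (\<tau> \<circ> \<phi>) ` xdarts) = card (xdarts - S)"
proof -
  have "S = I \<union> \<phi> ` I"
  proof (intro set_eqI iffI)
    fix d assume d: "d \<in> S"
    then have "d \<in> I \<or> \<phi> d \<in> I" "\<phi> (\<phi> d) = d" using rooted.I_\<phi>[OF d] \<phi>_\<phi> xdarts_dart by (auto simp: S_def)
    then show "d \<in> I \<union> \<phi> ` I" by (metis UnI1 UnI2 imageI)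
  qed (use rooted.I_S rooted.\<phi>_S in auto)
  moreover have "I \<inter> \<phi> ` I = {}" using rooted.I_\<phi> rooted.I_S by auto
  moreover have "inj_on \<phi> I" using map.bij_\<phi> rooted.I_A by (meson bij_betw_def inj_on_subset)
  ultimately have "card S = 2 * card I" using rooted.finite_I by (simp add: card_Un_disjoint card_image)
  moreover have "card (xdarts - S) = card xdarts - card S" "card S \<le> card xdarts"
    using rooted.S_in map.finite_A by (auto simp: card_Diff_subset finite_subset intro: card_mono)
  moreover have "2 * card (vertices T) = card (triangles T)"
    using euler card_edges by (simp add: euler_characteristic_def)
  ultimately show ?thesis using card_vertices card_triangles by simp
qed

end

section \<open>Cycles of the wreath, and separation\<close>

context toric_wreath begin

text \<open>\<open>par\<close> leads from an arc to the arc ending at its tail; the iterates form a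
  directed walk when listed in reverse.\<close>

lemma cas_par_walk:
  assumes i: "i \<in> I"
  shows "pre_digraph.cas (dual_graph T X) (apex ((rooted.par ^^ m) i))
    (map (\<lambda>k. edge_of T ((rooted.par ^^ k) i)) (rev [0..<m])) (apex i)"
proof (induct m)
  case 0
  show ?case by (simp add: pre_digraph.cas.simps)
next
  case (Suc m)
  have "(rooted.par ^^ m) i \<in> I" by (rule funpow_closed[OF rooted.par_image i])
  then show ?case
    using Suc tail_edge head_edge I_xdart I_white apex_par by (simp add: pre_digraph.cas.simps)
qed

text \<open>Since only one arc of \<open>W\<close> ends at each vertex, a walk in \<open>W\<close>
  is determined by its last arc.\<close>

lemma cas_imp_par_walk:
  assumes "pre_digraph.cas (dual_graph T X) u (map (edge_of T) q) v" "set q \<subseteq> I" "q \<noteq> []"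
  shows "q = map (\<lambda>k. (rooted.par ^^ k) (last q)) (rev [0..<length q]) \<and>
    u = apex ((rooted.par ^^ length q) (last q)) \<and> v = apex (last q)"
  using assms
proof (induct q arbitrary: u)
  case (Cons a q)
  have a: "a \<in> I" using Cons.prems by simp
  have u: "u = apex (rooted.par a)" and c: "pre_digraph.cas (dual_graph T X) (apex a) (map (edge_of T) q) v"
    using Cons.prems(1) tail_edge head_edge I_xdart[OF a] I_white[OF a] apex_par[OF a]
    by (auto simp: pre_digraph.cas.simps)
  show ?case
  proof (cases "q = []")
    case True
    then show ?thesis using u c by (simp add: pre_digraph.cas.simps)
  next
    case False
    let ?l = "last q"
    have IH: "q = map (\<lambda>k. (rooted.par ^^ k) ?l) (rev [0..<length q])"
      "apex a = apex ((rooted.par ^^ length q) ?l)" "v = apex ?l"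
      using Cons.hyps[OF c _ False] Cons.prems(2) by auto
    have "?l \<in> I" using False Cons.prems(2) by auto
    then have "(rooted.par ^^ length q) ?l \<in> I" by (rule funpow_closed[OF rooted.par_image])
    then have a': "a = (rooted.par ^^ length q) ?l" using IH(2) a apex_inj_I by (auto dest: inj_onD)
    then have "a # q = map (\<lambda>k. (rooted.par ^^ k) ?l) (rev [0..<length (a # q)])"
      using IH(1) by simp
    then show ?thesis using False u IH(3) a' by simp
  qed
qed simp

lemma cycles_eq: "cycles_in T X W = (\<lambda>C. edge_of T ` C) ` cyclic_orbits rooted.par I"
proof (intro set_eqI iffI)
  fix c assume "c \<in> cycles_in T X W"
  then obtain p u where p: "c = set p" "set p \<subseteq> W" "p \<noteq> []" "pre_digraph.cas (dual_graph T X) u p u"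
    by (auto simp: cycles_in_def pre_digraph.cycle_def pre_digraph.awalk_def)
  have "set p \<subseteq> edge_of T ` I" using W_I p(2) by blast
  then have "\<forall>e\<in>set p. inv_into I (edge_of T) e \<in> I \<and> edge_of T (inv_into I (edge_of T) e) = e"
    by (auto simp: inv_into_into f_inv_into_f)
  then have "set (map (inv_into I (edge_of T)) p) \<subseteq> I"
    "p = map (edge_of T) (map (inv_into I (edge_of T)) p)" by (auto intro!: map_idI[symmetric])
  then obtain q where q: "set q \<subseteq> I" "p = map (edge_of T) q" by blast
  have qne: "q \<noteq> []" using p(3) q(2) by auto
  let ?x = "last q" and ?l = "length q"
  have w: "q = map (\<lambda>k. (rooted.par ^^ k) ?x) (rev [0..<?l])" "apex ((rooted.par ^^ ?l) ?x) = apex ?x"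
    using cas_imp_par_walk[of u q u] p(4) q qne by auto
  have xI: "?x \<in> I" using q qne by auto
  then have "(rooted.par ^^ ?l) ?x \<in> I" by (rule funpow_closed[OF rooted.par_image])
  \<comment> \<open>The walk is closed, and an arc of \<open>W\<close> is determined by its head, so
    its last arc is periodic under \<open>par\<close>.\<close>
  then have per: "(rooted.par ^^ ?l) ?x = ?x" using w(2) xI apex_inj_I by (auto dest: inj_onD)
  have orb: "orbit rooted.par ?x = {(rooted.par ^^ m) ?x |m. m < ?l}"
    using orbit_altdef_bounded[OF per] qne by simp
  have "set q = {(rooted.par ^^ m) ?x |m. m < ?l}" by (subst w(1)) auto
  then have "set q = orbit rooted.par ?x" using orb by simp
  moreover have "?x \<in> set q" using qne by simp
  ultimately have "set q \<in> cyclic_orbits rooted.par I" using xI by (auto simp: cyclic_orbits_def)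
  then show "c \<in> (\<lambda>C. edge_of T ` C) ` cyclic_orbits rooted.par I" using p(1) q(2) by auto
next
  fix c assume "c \<in> (\<lambda>C. edge_of T ` C) ` cyclic_orbits rooted.par I"
  then obtain x where x: "x \<in> I" "x \<in> orbit rooted.par x" "c = edge_of T ` orbit rooted.par x"
    by (auto simp: cyclic_orbits_def)
  \<comment> \<open>The least positive period, so that the walk goes around once and its vertices
    are distinct, as \<open>cycle\<close> demands.\<close>
  define m where "m = funpow_dist1 rooted.par x x"
  define q where "q = map (\<lambda>k. (rooted.par ^^ k) x) (rev [0..<m])"
  have m: "(rooted.par ^^ m) x = x" unfolding m_def by (rule funpow_dist1_prop[OF x(2)])
  have setq: "set q = orbit rooted.par x"
    using orbit_conv_funpow_dist1[OF x(2), folded m_def] by (simp add: q_def)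
  then have qI: "set q \<subseteq> I" using orbit_subset_closed[of I rooted.par x] rooted.par_in x(1) by auto
  have dist: "distinct q"
    using inj_on_funpow_dist1[OF x(2), folded m_def] by (simp add: q_def distinct_map)
  let ?p = "map (edge_of T) q"
  have cas: "pre_digraph.cas (dual_graph T X) (apex x) ?p (apex x)"
    using cas_par_walk[OF x(1), of m] m by (simp add: q_def comp_def)
  have "q \<noteq> []" by (simp add: q_def m_def)
  then have "tl (pre_digraph.awalk_verts (dual_graph T X) (apex x) ?p) = map (head (dual_graph T X)) ?p"
    using pre_digraph.awalk_verts_conv'[OF cas] by simp
  also have "\<dots> = map apex q"
    using qI head_edge I_xdart I_white by auto
  finally have "distinct (tl (pre_digraph.awalk_verts (dual_graph T X) (apex x) ?p))"
    using dist qI apex_inj_I by (simp add: distinct_map inj_on_subset)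
  moreover have "set ?p \<subseteq> W" using qI I_W by auto
  moreover have "apex x \<in> verts (dual_graph T X)"
    using apex_vertex col_apex I_xdart[OF x(1)] by (simp add: dual_graph_def vertices_of_colour_def)
  moreover have "W \<subseteq> arcs (dual_graph T X)" using W_arcs by (simp add: dual_graph_def)
  ultimately have "pre_digraph.cycle (dual_graph T X) ?p"
    using cas \<open>q \<noteq> []\<close> by (auto simp: pre_digraph.cycle_def pre_digraph.awalk_def)
  then show "c \<in> cycles_in T X W" using \<open>set ?p \<subseteq> W\<close> x(3) setq by (auto simp: cycles_in_def intro!: exI[of _ ?p])
qed

lemma card_cycles: "card (cycles_in T X W) = card (cyclic_orbits rooted.par I)"
proof -
  have sub: "C \<subseteq> I" if "C \<in> cyclic_orbits rooted.par I" for C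
    using that cyclic_orbit_stable(1)[OF rooted.par_image] unfolding cyclic_orbits_def by blast
  have "inj_on (\<lambda>C. edge_of T ` C) (cyclic_orbits rooted.par I)"
    by (rule inj_onI) (use inj_on_image_eq_iff[OF edge_inj_I sub sub] in blast)
  then show ?thesis unfolding cycles_eq by (rule card_image)
qed

text \<open>Turns the condition on cycles of a wreath into \<open>nonsep\<close>: a proper
  \<open>K\<close> would yield a property of halves that is preserved by every contact but not
  shared by all halves.\<close>

lemma closed_if_not_separating:
  assumes C: "C \<in> cyclic_orbits rooted.par I" and K: "K \<subseteq> xdarts" "K \<noteq> {}"
    and K\<sigma>: "\<And>d. d \<in> K \<Longrightarrow> \<tau> (\<phi> d) \<in> K"
    and K\<phi>: "\<And>d. d \<in> K \<Longrightarrow> d \<notin> C \<Longrightarrow> \<phi> d \<notin> C \<Longrightarrow> \<phi> d \<in> K"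
  shows "K = xdarts"
proof (rule ccontr)
  assume "K \<noteq> xdarts"
  then obtain a b where ab: "a \<in> K" "b \<in> xdarts" "b \<notin> K" using K by auto
  interpret dual: ribbon_map xdarts "\<tau> \<circ> \<phi>" \<phi> by (rule map.dual)
  have \<sigma>: "\<tau> (\<phi> d) \<in> K \<longleftrightarrow> d \<in> K" if "d \<in> xdarts" for d
    using bij_betw_closed_iff[OF map.finite_A dual.bij_\<tau> K(1) _ that] K\<sigma> by simp
  \<comment> \<open>A half outside \<open>xdarts\<close> touches the half \<open>rot T d\<close>,
    which is in \<open>xdarts\<close>; this extends membership in \<open>K\<close> to all
    halves.\<close>
  define P where "P d \<longleftrightarrow> (if d \<in> xdarts then d else rot T d) \<in> K" for d
  let ?R = "contact T X (edge_of T ` C)"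
  have step: "P x \<longleftrightarrow> P y" if xy: "(x, y) \<in> ?R" for x y
  proof -
    consider "x \<in> halves T X" "y = rot T x"
      | "x \<in> darts T" "edge_of T x \<in> edges_of_colour T X - edge_of T ` C" "y = \<nu> x"
      using xy by (auto simp: contact_def)
    then show ?thesis
    proof cases
      case 1
      then have x: "x \<in> darts T" "col x \<noteq> X" by (auto simp: halves_def)
      show ?thesis
        using rot_xdart[OF x] \<sigma>[of x] 1(2) by (auto simp: P_def rot_rot)
    next
      case 2
      then have x: "x \<in> xdarts" by (simp add: xdarts_def)
      have "edge_of T (\<phi> x) = edge_of T x" using edge_\<phi> 2(1) by simp
      then have "x \<notin> C" "\<phi> x \<notin> C" using 2(2) by (metis DiffD2 imageI)+
      then have "\<phi> x \<in> K \<longleftrightarrow> x \<in> K" using K\<phi>[of x] K\<phi>[of "\<phi> x"] \<phi>_\<phi>[OF 2(1)] by auto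
      \<comment> \<open>The half across the median is thus represented by \<open>\<tau> x\<close>,
        which lies at the same dual vertex as \<open>\<phi> x\<close>: crossing the median is
        walking along the dual edge.\<close>
      moreover have "rot T (\<nu> x) = \<tau> x" by (simp add: rot_def \<tau>_def)
      moreover have "\<tau> x \<in> K \<longleftrightarrow> \<phi> x \<in> K" using \<sigma>[OF xdarts_\<phi>[OF x]] \<phi>_\<phi>[OF 2(1)] by simp
      ultimately show ?thesis using x xdarts_neq(1)[OF x] 2(3) by (simp add: P_def)
    qed
  qed
  have "P x \<longleftrightarrow> P y" if "(x, y) \<in> (?R \<union> ?R\<inverse>)\<^sup>*" for x y
    using that by (induct rule: rtrancl_induct) (use step in blast)+
  moreover have "P a" "\<not> P b" using ab K by (auto simp: P_def)
  ultimately have "(a, b) \<notin> (?R \<union> ?R\<inverse>)\<^sup>*" by blast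
  moreover have "a \<in> halves T X" "b \<in> halves T X"
    using ab K col_xdart xdarts_dart by (auto simp: halves_def)
  ultimately have "separating T X (edge_of T ` C)" unfolding separating_def by blast
  moreover have "edge_of T ` C \<in> cycles_in T X W" unfolding cycles_eq using C by blast
  ultimately show False using wreath by (auto simp: wreath_def)
qed

end

section \<open>White triangles and their arrows\<close>

context trinity_colour begin

definition white_xdarts :: "'d set" where "white_xdarts = {d \<in> xdarts. is_white d}"

lemma white_xdart: "d \<in> white_xdarts \<Longrightarrow> d \<in> xdarts" "d \<in> white_xdarts \<Longrightarrow> is_white d"
  by (auto simp: white_xdarts_def)

lemma white_xdart_dart: "d \<in> white_xdarts \<Longrightarrow> d \<in> darts T"
  using white_xdart xdarts_dart by blast

lemma triangle_white: "d \<in> white_xdarts \<Longrightarrow> triangle_of T d \<in> white_triangles T"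
  using white_triangle_iff white_xdart white_xdart_dart by simp

lemma white_triangles_eq: "white_triangles T = triangle_of T ` white_xdarts"
proof (intro set_eqI iffI)
  fix t assume t: "t \<in> white_triangles T"
  then obtain d where d: "d \<in> darts T" "t = triangle_of T d" by (auto simp: white_triangles_def triangles_def)
  then obtain e where e: "e \<in> xdarts" "triangle_of T e = t" using triangle_xdart by blast
  then have "is_white e" using t by (auto simp: is_white_def white_triangles_def)
  then show "t \<in> triangle_of T ` white_xdarts" using e by (auto simp: white_xdarts_def)
qed (use triangle_white in auto)

lemma triangle_inj_white: "inj_on (triangle_of T) white_xdarts"
  using triangle_xdart_unique white_xdart(1) by (auto intro!: inj_onI)

lemma vertices_distinct:
  assumes "d \<in> xdarts"
  shows "vertex_of T d \<noteq> vertex_of T (\<phi> d)" "apex d \<noteq> vertex_of T d" "apex d \<noteq> vertex_of T (\<phi> d)"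
  using col_\<phi>_neq[OF xdarts_dart[OF assms]] col_apex[OF assms] col_xdart[OF assms] col_xdart_\<phi>[OF assms]
  by auto

lemma arrows_eq:
  assumes s: "\<And>t. t \<in> white_triangles T \<Longrightarrow> s t \<in> vertex_of T ` t"
  shows "arrows T X s = edge_of T ` {d \<in> white_xdarts. s (triangle_of T d) = apex d}"
proof (intro set_eqI iffI)
  fix e assume "e \<in> arrows T X s"
  then obtain t where t: "t \<in> white_triangles T" "e \<in> edges T" "colouring T (s t) = X" "t \<inter> e \<noteq> {}"
    "s t \<notin> vertex_of T ` e" by (auto simp: arrows_def)
  obtain d where d: "d \<in> white_xdarts" "t = triangle_of T d" using t(1) white_triangles_eq by auto
  have dd: "d \<in> darts T" "d \<in> xdarts" using d white_xdart white_xdart_dart by auto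
  have "s t \<in> {vertex_of T d, vertex_of T (\<phi> d), apex d}"
    using s[OF t(1)] vertices_triangle[OF dd(1)] d(2) by simp
  then have st: "s t = apex d" using t(3) col_xdart[OF dd(2)] col_xdart_\<phi>[OF dd(2)] by (metis empty_iff insert_iff)
  obtain y where y: "y \<in> t" "y \<in> e" using t(4) by auto
  have "e = edge_of T y"
    using t(2) y(2) edge_\<phi> by (auto simp: edges_def edge_of_def)
  moreover have "y \<in> {d, \<nu> d, \<nu> (\<nu> d)}" using y d(2) triangle_eq[OF dd(1)] by simp
  \<comment> \<open>The other two sides of the triangle end at the apex, so the crossed side can
    only be that of \<open>d\<close>.\<close>
  moreover have "y \<noteq> \<nu> (\<nu> d)"
    using t(5) y(2) st by (auto simp: apex_def)
  moreover have "y \<noteq> \<nu> d"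
  proof
    assume "y = \<nu> d"
    then have "\<phi> (\<nu> d) \<in> e" using \<open>e = edge_of T y\<close> by (simp add: edge_of_def)
    then have "apex d \<in> vertex_of T ` e" using vertex_\<nu>[OF \<nu>_dart[OF dd(1)]] by (auto simp: apex_def)
    then show False using t(5) st by simp
  qed
  ultimately have "e = edge_of T d" by auto
  then show "e \<in> edge_of T ` {d \<in> white_xdarts. s (triangle_of T d) = apex d}" using d st by auto
next
  fix e assume "e \<in> edge_of T ` {d \<in> white_xdarts. s (triangle_of T d) = apex d}"
  then obtain d where d: "d \<in> white_xdarts" "s (triangle_of T d) = apex d" "e = edge_of T d" by auto
  then have dd: "d \<in> darts T" "d \<in> xdarts" using white_xdart white_xdart_dart by auto
  have "e \<in> edges T" using d dd by (auto simp: edges_def)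
  moreover have "triangle_of T d \<inter> e \<noteq> {}" using d triangle_self[OF dd(1)] by (auto simp: edge_of_def)
  moreover have "apex d \<notin> vertex_of T ` e" using vertices_distinct[OF dd(2)] d by (auto simp: edge_of_def)
  ultimately show "e \<in> arrows T X s"
    using triangle_white[OF d(1)] d(2) col_apex[OF dd(2)] by (auto simp: arrows_def intro!: bexI[of _ "triangle_of T d"])
qed

text \<open>Leads from either half-edge to the white triangle at the edge; in this way edges of
  colour \<open>X\<close> and white triangles correspond.\<close>

definition whiten :: "'d \<Rightarrow> 'd" where "whiten d = (if is_white d then d else \<phi> d)"

lemma whiten:
  assumes "d \<in> xdarts" shows "whiten d \<in> white_xdarts" "d = whiten d \<or> d = \<phi> (whiten d)"
    "whiten (\<phi> d) = whiten d"
  using assms white_\<phi>[of d] xdarts_dart[of d] \<phi>_\<phi>[of d] xdarts_\<phi>[of d]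
  by (auto simp: whiten_def white_xdarts_def)

lemma whiten_white: "d \<in> white_xdarts \<Longrightarrow> whiten d = d" "d \<in> white_xdarts \<Longrightarrow> whiten (\<phi> d) = d"
  using white_xdart whiten(3)[of d] by (auto simp: whiten_def)

end

section \<open>States extending the wreath as assignments of the remaining edges\<close>

context toric_wreath begin

lemma I_eq: "I = white_xdarts \<inter> S" by (auto simp: I_def white_xdarts_def S_def)

lemma arrows_eq_W:
  assumes s: "\<And>t. t \<in> white_triangles T \<Longrightarrow> s t \<in> vertex_of T ` t"
  shows "arrows T X s = W \<longleftrightarrow> (\<forall>d\<in>white_xdarts. s (triangle_of T d) = apex d \<longleftrightarrow> d \<in> I)"
proof -
  have inj: "inj_on (edge_of T) white_xdarts"
    using edge_eq_white white_xdart white_xdart_dart by (auto intro!: inj_onI)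
  have W: "edge_of T ` I = W" using W_I I_W by auto
  have "edge_of T ` {d \<in> white_xdarts. s (triangle_of T d) = apex d} = edge_of T ` I \<longleftrightarrow>
      {d \<in> white_xdarts. s (triangle_of T d) = apex d} = I"
    by (rule inj_on_image_eq_iff[OF inj]) (auto simp: I_eq)
  moreover have "arrows T X s = edge_of T ` {d \<in> white_xdarts. s (triangle_of T d) = apex d}"
    by (rule arrows_eq) (rule s)
  ultimately have "arrows T X s = W \<longleftrightarrow> {d \<in> white_xdarts. s (triangle_of T d) = apex d} = I"
    unfolding W by simp
  also have "\<dots> \<longleftrightarrow> (\<forall>d\<in>white_xdarts. s (triangle_of T d) = apex d \<longleftrightarrow> d \<in> I)" by (auto simp: I_eq)
  finally show ?thesis .
qed

text \<open>In the dual map a half-edge lies at its initial vertex, so \<open>d\<close> records that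
  its edge is owned by the vertex matched with the white triangle at the edge.\<close>

definition chosen :: "('d set \<Rightarrow> 'd set) \<Rightarrow> 'd set" where
  "chosen s = {d \<in> xdarts - S. s (triangle_of T (whiten d)) = vertex_of T d}"

definition state_value :: "'d set \<Rightarrow> 'd \<Rightarrow> 'd set" where
  "state_value J d = (if d \<in> I then apex d else if d \<in> J then vertex_of T d else vertex_of T (\<phi> d))"

definition state_of :: "'d set \<Rightarrow> 'd set \<Rightarrow> 'd set" where
  "state_of J = restrict (\<lambda>t. state_value J (inv_into white_xdarts (triangle_of T) t)) (white_triangles T)"

lemma state_of_triangle: "d \<in> white_xdarts \<Longrightarrow> state_of J (triangle_of T d) = state_value J d"
  using triangle_white triangle_inj_white by (simp add: state_of_def)

interpretation dual: ribbon_map xdarts "\<tau> \<circ> \<phi>" \<phi> by (rule map.dual)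

lemma \<phi>_compl_S: "d \<in> xdarts - S \<Longrightarrow> \<phi> d \<in> xdarts - S"
  using xdarts_\<phi> rooted.\<phi>_S \<phi>_\<phi> xdarts_dart by (metis Diff_iff)

lemma whiten_not_I: "d \<in> xdarts - S \<Longrightarrow> whiten d \<notin> I"
  using \<phi>_compl_S[of d] by (auto simp: whiten_def I_eq)

lemma state_value_vertex:
  assumes J: "J \<in> dual.transversals (xdarts - S)" and d: "d \<in> xdarts - S"
  shows "state_value J (whiten d) = vertex_of T d \<longleftrightarrow> d \<in> J"
proof -
  have dd: "d \<in> xdarts" "d \<in> darts T" using d xdarts_dart by auto
  have "d \<in> J \<longleftrightarrow> \<phi> d \<notin> J" using J d by (auto simp: dual.transversals_def)
  then show ?thesis
    using whiten_not_I[OF d] vertices_distinct(1)[OF dd(1)] \<phi>_\<phi>[OF dd(2)] by (auto simp: state_value_def whiten_def)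
qed

text \<open>A state extends \<open>W\<close> exactly when the triangles of \<open>I\<close> are the
  ones matched with their apex. The other white triangles stand for the edges outside
  \<open>S\<close> and are matched with an end of their edge; that this is a bijection onto the
  remaining vertices is the condition for a transversal.\<close>

lemma bij_chosen:
  "bij_betw chosen {s \<in> states T. arrows T X s = W} (dual.transversals (xdarts - S))"
proof (rule bij_betw_byWitness[where f' = state_of])
  have val: "s (triangle_of T d) = apex d \<longleftrightarrow> d \<in> I"
    "s (triangle_of T d) \<in> {vertex_of T d, vertex_of T (\<phi> d), apex d}"
    if s: "s \<in> {s \<in> states T. arrows T X s = W}" and d: "d \<in> white_xdarts" for s d
  proof -
    have sv: "s t \<in> vertex_of T ` t" if "t \<in> white_triangles T" for t using s that by (auto simp: states_def)
    show "s (triangle_of T d) = apex d \<longleftrightarrow> d \<in> I" using arrows_eq_W[of s, OF sv] s d by auto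
    show "s (triangle_of T d) \<in> {vertex_of T d, vertex_of T (\<phi> d), apex d}"
      using sv[OF triangle_white[OF d]] vertices_triangle[OF white_xdart_dart[OF d]] by simp
  qed
  show "\<forall>s\<in>{s \<in> states T. arrows T X s = W}. state_of (chosen s) = s"
  proof
    fix s assume s: "s \<in> {s \<in> states T. arrows T X s = W}"
    show "state_of (chosen s) = s"
    proof (rule extensionalityI[of _ "white_triangles T"])
      show "state_of (chosen s) \<in> extensional (white_triangles T)" by (simp add: state_of_def)
      show "s \<in> extensional (white_triangles T)" using s by (simp add: states_def)
      fix t assume "t \<in> white_triangles T"
      then obtain d where d: "d \<in> white_xdarts" "t = triangle_of T d" using white_triangles_eq by auto
      have "d \<in> chosen s \<longleftrightarrow> d \<notin> I \<and> s t = vertex_of T d"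
        using d white_xdart[OF d(1)] whiten_white(1)[OF d(1)] by (auto simp: chosen_def I_eq)
      then show "state_of (chosen s) t = s t"
        using val[OF s d(1)] d by (auto simp: state_of_triangle state_value_def)
    qed
  qed
  show "\<forall>J\<in>dual.transversals (xdarts - S). chosen (state_of J) = J"
  proof
    fix J assume J: "J \<in> dual.transversals (xdarts - S)"
    have "d \<in> chosen (state_of J) \<longleftrightarrow> d \<in> J" if "d \<in> xdarts - S" for d
      using that state_value_vertex[OF J that] state_of_triangle[OF whiten(1)[of d]] by (auto simp: chosen_def)
    moreover have "J \<subseteq> xdarts - S" using J by (simp add: dual.transversals_def)
    ultimately show "chosen (state_of J) = J" by (auto simp: chosen_def)
  qed
  show "chosen ` {s \<in> states T. arrows T X s = W} \<subseteq> dual.transversals (xdarts - S)"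
  proof
    fix J assume "J \<in> chosen ` {s \<in> states T. arrows T X s = W}"
    then obtain s where s: "s \<in> {s \<in> states T. arrows T X s = W}" and J: "J = chosen s" by auto
    have bij: "bij_betw s (white_triangles T) (vertices T)" using s by (simp add: states_def)
    have two: "s (triangle_of T (whiten d)) = vertex_of T d \<or> s (triangle_of T (whiten d)) = vertex_of T (\<phi> d)"
      if d: "d \<in> xdarts - S" for d
    proof -
      have "s (triangle_of T (whiten d)) \<in> {vertex_of T (whiten d), vertex_of T (\<phi> (whiten d))}"
        using val[OF s whiten(1)[of d]] whiten_not_I[OF d] d by auto
      then show ?thesis using \<phi>_\<phi>[of d] d xdarts_dart by (auto simp: whiten_def split: if_splits)
    qed
    show "J \<in> dual.transversals (xdarts - S)"
      unfolding dual.transversals_def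
    proof (intro CollectI conjI ballI)
      show "J \<subseteq> xdarts - S" by (auto simp: J chosen_def)
      show "d \<in> J \<longleftrightarrow> \<phi> d \<notin> J" if d: "d \<in> xdarts - S" for d
        using two[OF d] d \<phi>_compl_S[OF d] whiten(3)[of d] vertices_distinct(1)[of d]
        by (auto simp: J chosen_def)
      show "\<exists>!j. j \<in> J \<and> j \<in> orbit (\<tau> \<circ> \<phi>) d" if d: "d \<in> xdarts" for d
      proof -
        \<comment> \<open>Surjectivity of \<open>s\<close> provides the edge owned by this vertex;
          injectivity makes it unique.\<close>
        have "vertex_of T d \<in> s ` white_triangles T"
          using vertex_vertex[OF d] bij by (simp add: bij_betw_def)
        then obtain w where w: "w \<in> white_xdarts" "s (triangle_of T w) = vertex_of T d"
          unfolding white_triangles_eq by auto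
        have "w \<notin> I"
        proof
          assume "w \<in> I"
          then have "s (triangle_of T w) = apex w" using val(1)[OF s w(1)] by simp
          then show False using w(2) col_apex[OF white_xdart(1)[OF w(1)]] col_xdart[OF d] by simp
        qed
        then have wS: "w \<in> xdarts - S" using w white_xdart by (auto simp: I_eq)
        then have "w \<in> J \<or> \<phi> w \<in> J"
          using two[OF wS] whiten_white[OF w(1)] \<phi>_compl_S[OF wS] by (auto simp: J chosen_def)
        then obtain j where j: "j \<in> J" "whiten j = w" using whiten_white[OF w(1)] by auto
        have Jx: "x \<in> xdarts" "s (triangle_of T (whiten x)) = vertex_of T x" if "x \<in> J" for x
          using that by (auto simp: J chosen_def)
        have "vertex_of T j = vertex_of T d" using Jx(2)[OF j(1)] j(2) w(2) by simp
        then have "j \<in> orbit (\<tau> \<circ> \<phi>) d" using orbit_\<sigma>_iff[OF d Jx(1)[OF j(1)]] by simp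
        moreover have "x = j" if x: "x \<in> J" "x \<in> orbit (\<tau> \<circ> \<phi>) d" for x
        proof -
          have vx: "vertex_of T x = vertex_of T d" using orbit_\<sigma>_iff[OF d Jx(1)[OF x(1)]] x(2) by simp
          have "s (triangle_of T (whiten x)) = s (triangle_of T w)" using Jx(2)[OF x(1)] vx w(2) by simp
          then have "triangle_of T (whiten x) = triangle_of T w"
            using bij triangle_white[OF w(1)] triangle_white[OF whiten(1)[OF Jx(1)[OF x(1)]]]
            by (auto simp: bij_betw_def dest: inj_onD)
          then have wx: "whiten x = w"
            using triangle_inj_white w(1) whiten(1)[OF Jx(1)[OF x(1)]] by (auto dest: inj_onD)
          have "x = w \<or> x = \<phi> w" "j = w \<or> j = \<phi> w"
            using whiten(2)[OF Jx(1)[OF x(1)]] whiten(2)[OF Jx(1)[OF j(1)]] wx j(2) by auto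
          then show ?thesis
            using vertices_distinct(1)[OF white_xdart(1)[OF w(1)]] vx \<open>vertex_of T j = vertex_of T d\<close> by auto
        qed
        ultimately show ?thesis using j(1) by blast
      qed
    qed
  qed
  show "state_of ` dual.transversals (xdarts - S) \<subseteq> {s \<in> states T. arrows T X s = W}"
  proof
    fix s assume "s \<in> state_of ` dual.transversals (xdarts - S)"
    then obtain J where J: "J \<in> dual.transversals (xdarts - S)" and s: "s = state_of J" by auto
    have JS: "J \<subseteq> xdarts - S" and J1: "\<And>d. d \<in> xdarts \<Longrightarrow> \<exists>!j. j \<in> J \<and> j \<in> orbit (\<tau> \<circ> \<phi>) d"
      and J\<phi>: "\<And>d. d \<in> xdarts - S \<Longrightarrow> d \<in> J \<longleftrightarrow> \<phi> d \<notin> J"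
      using J by (auto simp: dual.transversals_def)
    have sv: "s t \<in> vertex_of T ` t" if t: "t \<in> white_triangles T" for t
    proof -
      obtain d where d: "d \<in> white_xdarts" "t = triangle_of T d" using t white_triangles_eq by auto
      then show ?thesis
        using vertices_triangle[OF white_xdart_dart[OF d(1)]] state_of_triangle[OF d(1)]
        by (auto simp: s state_value_def)
    qed
    have apex_iff: "s (triangle_of T d) = apex d \<longleftrightarrow> d \<in> I" if d: "d \<in> white_xdarts" for d
      using state_of_triangle[OF d, of J] vertices_distinct[OF white_xdart(1)[OF d]]
      by (auto simp: s state_value_def)
    have sJ: "s (triangle_of T (whiten j)) = vertex_of T j" if "j \<in> J" for j
      using state_value_vertex[OF J, of j] that JS state_of_triangle[OF whiten(1)[of j], of J] by (auto simp: s)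
    have ex_j: "\<exists>j\<in>J. whiten j = d" if d: "d \<in> white_xdarts" "d \<notin> I" for d
    proof -
      have "d \<in> xdarts - S" using d white_xdart by (auto simp: I_eq)
      then have "d \<in> J \<or> \<phi> d \<in> J" using J\<phi> by auto
      then show ?thesis using whiten_white[OF d(1)] by blast
    qed
    have col_iff: "colouring T (s (triangle_of T d)) = X \<longleftrightarrow> d \<in> I" if d: "d \<in> white_xdarts" for d
    proof (cases "d \<in> I")
      case True
      then show ?thesis using apex_iff[OF d] col_apex[OF white_xdart(1)[OF d]] by simp
    next
      case False
      then obtain j where "j \<in> J" "whiten j = d" using ex_j[OF d] by auto
      then show ?thesis using sJ[of j] col_xdart[of j] JS False by auto
    qed
    have inj: "inj_on s (white_triangles T)"
    proof (rule inj_onI)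
      fix t t' assume t: "t \<in> white_triangles T" "t' \<in> white_triangles T" "s t = s t'"
      obtain d d' where d: "d \<in> white_xdarts" "t = triangle_of T d" "d' \<in> white_xdarts" "t' = triangle_of T d'"
        using t(1,2) white_triangles_eq by auto
      \<comment> \<open>The colour of the common value tells which kind of triangle it comes from.
        Within \<open>I\<close> the apex identifies the triangle, outside \<open>I\<close> the
        transversal does.\<close>
      have "d \<in> I \<longleftrightarrow> d' \<in> I" using col_iff[OF d(1)] col_iff[OF d(3)] t(3) d by simp
      then consider "d \<in> I" "d' \<in> I" | "d \<notin> I" "d' \<notin> I" by blast
      then have "d = d'"
      proof cases
        case 1
        then have "apex d = apex d'" using apex_iff[OF d(1)] apex_iff[OF d(3)] t(3) d by simp
        then show ?thesis using 1 apex_inj_I by (auto dest: inj_onD)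
      next
        case 2
        obtain j j' where j: "j \<in> J" "whiten j = d" "j' \<in> J" "whiten j' = d'"
          using ex_j[OF d(1) 2(1)] ex_j[OF d(3) 2(2)] by auto
        have jA: "j \<in> xdarts" "j' \<in> xdarts" using j JS by auto
        have "vertex_of T j = vertex_of T j'" using sJ[OF j(1)] sJ[OF j(3)] j t(3) d by simp
        then have "j' \<in> orbit (\<tau> \<circ> \<phi>) j" using orbit_\<sigma>_iff[OF jA] by simp
        then have "j' = j" using J1[OF jA(1)] j dual.self_orbit[OF jA(1)] by blast
        then show ?thesis using j by simp
      qed
      then show "t = t'" using d by simp
    qed
    have surj: "s ` white_triangles T = vertices T"
    proof (intro set_eqI iffI)
      fix v assume "v \<in> s ` white_triangles T"
      then obtain t where t: "t \<in> white_triangles T" "v = s t" by auto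
      obtain d where d: "d \<in> white_xdarts" "t = triangle_of T d" using t white_triangles_eq by auto
      have "v \<in> {vertex_of T d, vertex_of T (\<phi> d), apex d}"
        using sv[OF t(1)] t(2) d vertices_triangle[OF white_xdart_dart[OF d(1)]] by simp
      then show "v \<in> vertices T"
        using vertex_vertex apex_vertex white_xdart(1)[OF d(1)] xdarts_\<phi> by auto
    next
      fix v assume v: "v \<in> vertices T"
      show "v \<in> s ` white_triangles T"
      proof (cases "colouring T v = X")
        case True
        then obtain d where d: "d \<in> xdarts" "v = apex d" using vertex_of_colour_xdart[OF v] by auto
        then obtain i where i: "i \<in> I" "apex i = v" using ex1_I by blast
        then have "i \<in> white_xdarts" by (simp add: I_eq)
        then show ?thesis using apex_iff i triangle_white by (metis imageI)
      next
        case False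
        then obtain d where d: "d \<in> xdarts" "v = vertex_of T d" using vertex_not_colour_xdart[OF v] by auto
        then obtain j where j: "j \<in> J" "j \<in> orbit (\<tau> \<circ> \<phi>) d" using J1 by blast
        have jA: "j \<in> xdarts" using j JS by auto
        have "vertex_of T j = v" using orbit_\<sigma>_iff[OF d(1) jA] j d by simp
        then have "s (triangle_of T (whiten j)) = v" using sJ[OF j(1)] by simp
        then show ?thesis using triangle_white[OF whiten(1)[OF jA]] by (metis imageI)
      qed
    qed
    have "s \<in> states T"
      using inj surj sv by (auto simp: states_def bij_betw_def s state_of_def)
    then show "s \<in> {s \<in> states T. arrows T X s = W}" using arrows_eq_W[of s, OF sv] apex_iff by simp
  qed
qed

end

theorem theorem5p3:
  fixes T :: "'d tri_map" and X :: colour and W :: "'d set set" and k :: nat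
  assumes "toric_trinity T"
    and "wreath T X W"
    and "card (cycles_in T X W) = k"
  shows "card {s \<in> states T. arrows T X s = W} = 2 ^ k"
proof -
  interpret toric_wreath T X W
    using assms(1,2) by unfold_locales (auto simp: toric_trinity_def)
  have "card {s \<in> states T. arrows T X s = W} =
      card (ribbon_map.transversals xdarts (\<tau> \<circ> \<phi>) \<phi> (xdarts - S))"
    by (rule bij_betw_same_card[OF bij_chosen])
  also have "\<dots> = 2 ^ card (cyclic_orbits rooted.par I)"
    by (rule rooted.card_dual_transversals[OF closed_if_not_separating card_\<sigma>_orbits])
  also have "\<dots> = 2 ^ k" using card_cycles assms(3) by simp
  finally show ?thesis .
qed

end
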